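(* Let $d\ge1$. For $\delta>0$ let $I(\mu)$ be the geodesic distance energy integral $$I(\mu)=\int_{\mathbb S^d}\int_{\mathbb S^d}\big(d(x,y)\big)^\delta\,d\mu(x)\,d\mu(y).$$ The maximizers of $I$ over $\mu\in\mathcal M$ can be characterized as follows: (i) if $0<\delta<1$, the unique maximizer of $I(\mu)$ is $\mu=\sigma$; (ii) if $\delta=1$, $I(\mu)$ is maximized if and only if $\mu$ is centrally symmetric; (iii) if $\delta>1$, $I(\mu)$ is maximized if and only if $\mu=\frac12(\delta_p+\delta_{-p})$ for some $p\in\mathbb S^d$, i.e. the mass is equally concentrated at two antipodal poles.
   Context: $\mathbb S^d\subset\mathbb R^{d+1}$ is the unit sphere, $\sigma$ is the normalized surface measure ($\sigma(\mathbb S^d)=1$), $d(x,y)=\frac1\pi\arccos(x\cdot y)$ is the normalized geodesic distance, and $\mathcal M$ is the set of Borel probability measures on $\mathbb S^d$. A measure $\mu$ is centrally symmetric if $\mu(E)=\mu(-E)$ for every Borel set $E\subset\mathbb S^d$. $\delta_p$ denotes the Dirac mass at $p$ (as opposed to the exponent $\delta$). *)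

theory Defs
  imports "HOL-Probability.Probability"
begin

definition sphere_borel :: "'a::euclidean_space measure" where
  "sphere_borel = restrict_space borel (sphere 0 1)"

definition sphere_prob_measures :: "'a::euclidean_space measure set" where
  "sphere_prob_measures = {\<mu>. sets \<mu> = sets sphere_borel \<and> prob_space \<mu>}"

text \<open>
  Surface measure on the unit sphere as it arises from polar coordinates: the measure of a Borel
  set \<open>E\<close> is the dimension of the ambient space times the Lebesgue measure of the cone
  \<open>{r x | 0 < r \<le> 1, x \<in> E}\<close> (see \<open>emeasure_sphere_surface\<close>).  That cone is the preimage of \<open>E\<close>
  under the radial projection of the punctured unit ball, so the measure is a pushforward.
\<close>

definition sphere_surface :: "'a::euclidean_space measure" where
  "sphere_surface = scale_measure (of_nat DIM('a))
     (distr (restrict_space lborel (cball 0 1 - {0})) sphere_borel (\<lambda>x. x /\<^sub>R norm x))"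

definition sphere_sigma :: "'a::euclidean_space measure" where
  "sphere_sigma = uniform_measure sphere_surface (sphere 0 1)"

definition geo_dist :: "'a::euclidean_space \<Rightarrow> 'a \<Rightarrow> real" where
  "geo_dist x y = arccos (x \<bullet> y) / pi"

definition geo_energy :: "real \<Rightarrow> 'a::euclidean_space measure \<Rightarrow> real" where
  "geo_energy \<delta> \<mu> = (LINT y|\<mu>. LINT x|\<mu>. geo_dist x y powr \<delta>)"

definition centrally_symmetric :: "'a::euclidean_space measure \<Rightarrow> bool" where
  "centrally_symmetric \<mu> \<longleftrightarrow> (\<forall>E\<in>sets \<mu>. emeasure \<mu> E = emeasure \<mu> (uminus ` E))"

text \<open>
  The mixture of the Dirac masses at \<open>p\<close> and \<open>- p\<close> with weights one half. Measures have no addition,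
  hence the definition by values; \<open>measure_of\<close> does not degenerate (see \<open>emeasure_antipodal_dirac\<close>).
\<close>

definition antipodal_dirac :: "'a::euclidean_space \<Rightarrow> 'a measure" where
  "antipodal_dirac p = measure_of (sphere 0 1) (sets sphere_borel)
     (\<lambda>E. (emeasure (return sphere_borel p) E + emeasure (return sphere_borel (- p)) E) / 2)"

lemma space_sphere_borel [simp]: "space sphere_borel = sphere 0 1"
  by (simp add: sphere_borel_def space_restrict_space)

lemma sets_sphere_surface [simp, measurable_cong]: "sets sphere_surface = sets sphere_borel"
  by (simp add: sphere_surface_def)

lemma sets_sphere_sigma [simp, measurable_cong]: "sets sphere_sigma = sets sphere_borel"
  by (simp add: sphere_sigma_def)

lemma radial_projection_measurable:
  "(\<lambda>x. x /\<^sub>R norm x) \<in>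
     restrict_space lborel (cball 0 1 - {0}) \<rightarrow>\<^sub>M (sphere_borel :: 'a::euclidean_space measure)"
proof -
  have "(\<lambda>x::'a. x /\<^sub>R norm x) \<in> restrict_space lborel (cball 0 1 - {0}) \<rightarrow>\<^sub>M borel"
    by (rule measurable_restrict_space1) simp
  then show ?thesis
    unfolding sphere_borel_def
    by (rule measurable_restrict_space2[rotated]) (auto simp: space_restrict_space)
qed

lemma emeasure_sphere_surface:
  fixes E :: "'a::euclidean_space set"
  assumes E: "E \<in> sets sphere_borel"
  shows "emeasure sphere_surface E =
    of_nat DIM('a) * emeasure lborel {r *\<^sub>R x | r x. 0 < r \<and> r \<le> 1 \<and> x \<in> E}"
proof -
  let ?f = "\<lambda>x::'a. x /\<^sub>R norm x" and ?B = "cball 0 1 - {0::'a}"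
  have sub: "E \<subseteq> sphere 0 1"
    using sets.sets_into_space[OF E] by simp
  have cone: "?f -` E \<inter> ?B = {r *\<^sub>R x | r x. 0 < r \<and> r \<le> 1 \<and> x \<in> E}" (is "?L = ?R")
  proof
    show "?L \<subseteq> ?R"
    proof
      fix x assume x: "x \<in> ?L"
      then have "x = norm x *\<^sub>R ?f x" "0 < norm x" "norm x \<le> 1" "?f x \<in> E"
        by auto
      then show "x \<in> ?R" by blast
    qed
    show "?R \<subseteq> ?L"
    proof
      fix y assume "y \<in> ?R"
      then obtain r x where y: "y = r *\<^sub>R x" "0 < r" "r \<le> 1" "x \<in> E" by blast
      then have "norm x = 1" using sub by auto
      with y show "y \<in> ?L" by auto
    qed
  qed
  have "emeasure (restrict_space lborel ?B) (?f -` E \<inter> ?B) = emeasure lborel (?f -` E \<inter> ?B)"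
    by (rule emeasure_restrict_space) auto
  then show ?thesis
    using E radial_projection_measurable[where 'a='a]
    by (simp add: sphere_surface_def emeasure_distr space_restrict_space flip: cone)
qed

lemma sphere_sigma_in_sphere_prob_measures: "sphere_sigma \<in> sphere_prob_measures"
proof -
  let ?C = "{r *\<^sub>R x | r x. 0 < r \<and> r \<le> 1 \<and> x \<in> sphere (0::'a::euclidean_space) 1}"
  have C: "?C = cball 0 1 - {0}" (is "_ = ?B")
  proof
    show "?C \<subseteq> ?B" by auto
    show "?B \<subseteq> ?C"
    proof
      fix x assume "x \<in> ?B"
      then have "x = norm x *\<^sub>R (x /\<^sub>R norm x)" "0 < norm x" "norm x \<le> 1"
        "x /\<^sub>R norm x \<in> sphere 0 1" by auto
      then show "x \<in> ?C" by blast
    qed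
  qed
  have S: "sphere (0::'a) 1 \<in> sets sphere_borel"
    using sets.top[of "sphere_borel :: 'a measure"] by simp
  have ball: "emeasure lborel ?B = emeasure lborel (cball (0::'a) 1)"
    by (rule emeasure_Diff_null_set) (auto simp: null_sets_def)
  have pos: "emeasure lborel (cball (0::'a) 1) \<noteq> 0"
  proof
    assume "emeasure lborel (cball (0::'a) 1) = 0"
    moreover have "emeasure lborel (ball (0::'a) 1) \<le> emeasure lborel (cball (0::'a) 1)"
      by (rule emeasure_mono) auto
    ultimately have "emeasure lborel (ball (0::'a) 1) = 0" by simp
    then have "measure lborel (ball (0::'a) 1) = 0" by (simp add: measure_def)
    then show False using content_ball_pos[of 1 "0::'a"] by simp
  qed
  have fin: "emeasure lborel (cball (0::'a) 1) < \<infinity>"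
    by (rule emeasure_bounded_finite) simp
  have eq: "emeasure sphere_surface (sphere (0::'a) 1) =
      of_nat DIM('a) * emeasure lborel (cball (0::'a) 1)"
    unfolding emeasure_sphere_surface[OF S] C ball ..
  have "prob_space (sphere_sigma :: 'a measure)"
    unfolding sphere_sigma_def
    by (rule prob_space_uniform_measure)
       (use pos fin in \<open>auto simp: eq ennreal_mult_eq_top_iff\<close>)
  then show ?thesis by (simp add: sphere_prob_measures_def)
qed

lemma sets_antipodal_dirac [simp]: "sets (antipodal_dirac p) = sets sphere_borel"
  unfolding antipodal_dirac_def
  by (metis sets.sets_measure_of_eq space_sphere_borel)

lemma emeasure_antipodal_dirac:
  fixes p :: "'a::euclidean_space"
  assumes E: "E \<in> sets sphere_borel"
  shows "emeasure (antipodal_dirac p) E =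
    (emeasure (return sphere_borel p) E + emeasure (return sphere_borel (- p)) E) / 2"
proof (rule emeasure_measure_of[OF antipodal_dirac_def])
  show "sets sphere_borel \<subseteq> Pow (sphere 0 1)"
    using sets.space_closed[of sphere_borel] by simp
  show "E \<in> sets (antipodal_dirac p)" using E by simp
  show "positive (sets (antipodal_dirac p))
     (\<lambda>E. (emeasure (return sphere_borel p) E + emeasure (return sphere_borel (- p)) E) / 2)"
    by (simp add: positive_def)
  show "countably_additive (sets (antipodal_dirac p))
     (\<lambda>E. (emeasure (return sphere_borel p) E + emeasure (return sphere_borel (- p)) E) / 2)"
  proof (rule countably_additiveI)
    fix A :: "nat \<Rightarrow> 'a set"
    assume A: "range A \<subseteq> sets (antipodal_dirac p)" "disjoint_family A"
    have s: "(\<Sum>i. emeasure (return sphere_borel q) (A i)) =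
        emeasure (return sphere_borel q) (\<Union>i. A i)" for q :: 'a
      using A by (intro suminf_emeasure) auto
    show "(\<Sum>i. (emeasure (return sphere_borel p) (A i) +
          emeasure (return sphere_borel (- p)) (A i)) / 2) =
        (emeasure (return sphere_borel p) (\<Union>i. A i) +
          emeasure (return sphere_borel (- p)) (\<Union>i. A i)) / 2"
      by (simp add: divide_ennreal_def ennreal_suminf_multc suminf_add[symmetric] s)
  qed
qed

end

theory Submission
  imports Defs
begin

text \<open>
  Write \<open>t = x \<bullet> y\<close> and \<open>s = (2 / pi) * arcsin t\<close>, so that \<open>d(x, y) = (1 - s) / 2\<close>. The kernel \<open>t ^ m\<close> is
  positive semidefinite: integrated against a signed measure in both variables it gives the sum of
  the squares of the moments of degree \<open>m\<close>. As \<open>arcsin\<close> has nonnegative Taylor coefficients, positive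
  in odd degrees, \<open>I(\<mu>) = 1/2\<close> minus a weighted sum of the squared odd moments when \<open>\<delta> = 1\<close>; hence
  \<open>I(\<mu>) \<le> 1/2\<close>, with equality exactly for the symmetric measures. For \<open>0 < \<delta> < 1\<close> the binomial series
  \<open>(1 - s) powr \<delta> = 1 - (\<Sum>k\<ge>1. b k * s ^ k)\<close> has \<open>b k > 0\<close>, so the energy of \<open>\<mu> - \<sigma>\<close> is nonpositive and
  vanishes only if all moments of \<open>\<mu>\<close> and \<open>\<sigma>\<close> agree; it equals \<open>I(\<mu>) - I(\<sigma>)\<close> because the potential of
  the rotation-invariant \<open>\<sigma>\<close> is constant on the sphere. For \<open>\<delta> > 1\<close> one has \<open>d powr \<delta> \<le> d\<close> with
  equality only for \<open>d \<in> {0, 1}\<close>, which reduces the claim to \<open>\<delta> = 1\<close>.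
\<close>

section \<open>Power series with nonnegative coefficients\<close>

text \<open>Nonnegative coefficients yield an Abel theorem at both endpoints: the partial sums at 1
  stay below \<open>f 1\<close>, so the Weierstrass test applies with majorant \<open>a\<close>, and
  continuity carries the identity to the closed interval. The endpoints are the inner products of
  equal and of antipodal points.\<close>

lemma power_series_closed_interval:
  fixes a :: "nat \<Rightarrow> real" and f :: "real \<Rightarrow> real"
  assumes a: "\<And>k. 0 \<le> a k"
    and f: "continuous_on {-1..1} f"
    and sums: "\<And>t. \<bar>t\<bar> < 1 \<Longrightarrow> (\<lambda>k. a k * t ^ k) sums f t"
  shows "summable a" and "\<And>t. \<bar>t\<bar> \<le> 1 \<Longrightarrow> (\<lambda>k. a k * t ^ k) sums f t"
proof -
  have part: "(\<Sum>k<N. a k) \<le> f 1" for N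
  proof -
    \<comment> \<open>For \<open>0 \<le> t < 1\<close> the omitted terms of the series are
      nonnegative; the bound at 1 follows by letting \<open>t\<close> tend to 1.\<close>
    have "f 1 - (\<Sum>k<N. a k * 1 ^ k) \<ge> 0"
    proof (rule continuous_ge_on_closure[where S="{0..<1}" and f="\<lambda>t. f t - (\<Sum>k<N. a k * t ^ k)"])
      show "continuous_on (closure {0..<1}) (\<lambda>t. f t - (\<Sum>k<N. a k * t ^ k))"
        by (auto intro!: continuous_intros continuous_on_subset[OF f])
      fix t :: real assume "t \<in> {0..<1}"
      then show "0 \<le> f t - (\<Sum>k<N. a k * t ^ k)"
        using sums[of t] a sum_le_suminf[of "\<lambda>k. a k * t ^ k" "{..<N}"]
        by (auto simp: sums_iff)
    qed simp
    then show ?thesis by simp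
  qed
  show summ: "summable a"
    by (rule summableI_nonneg_bounded[OF a part])
  have unif: "uniform_limit {-1..1} (\<lambda>n t. \<Sum>k<n. a k * t ^ k) (\<lambda>t. \<Sum>k. a k * t ^ k) sequentially"
  proof (rule Weierstrass_m_test[OF _ summ])
    fix n and t :: real assume "t \<in> {-1..1}"
    then have "\<bar>t\<bar> ^ n \<le> 1" by (intro power_le_one) auto
    then show "norm (a n * t ^ n) \<le> a n"
      using mult_left_mono[of "\<bar>t\<bar> ^ n" 1 "a n"] a[of n] by (simp add: abs_mult power_abs)
  qed
  have cont: "continuous_on {-1..1} (\<lambda>t. \<Sum>k. a k * t ^ k)"
    by (rule uniform_limit_theorem[OF _ unif]) (auto intro!: always_eventually continuous_intros)
  fix t :: real assume t: "\<bar>t\<bar> \<le> 1"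
  have "f t - (\<Sum>k. a k * t ^ k) = 0"
  proof (rule continuous_constant_on_closure[where S="{-1<..<1}" and f="\<lambda>t. f t - (\<Sum>k. a k * t ^ k)"])
    show "continuous_on (closure {-1<..<1}) (\<lambda>t. f t - (\<Sum>k. a k * t ^ k))"
      using f cont by (auto intro!: continuous_intros)
    show "f t - (\<Sum>k. a k * t ^ k) = 0" if "t \<in> {-1<..<1}" for t
      using sums[of t] that by (auto simp: sums_iff abs_less_iff)
    show "t \<in> closure {-1<..<1}" using t by auto
  qed
  moreover have "summable (\<lambda>k. a k * t ^ k)"
  proof (rule summable_comparison_test'[OF summ])
    fix n
    have "\<bar>t\<bar> ^ n \<le> 1" using t by (intro power_le_one) auto
    then show "norm (a n * t ^ n) \<le> a n"
      using mult_left_mono[of "\<bar>t\<bar> ^ n" 1 "a n"] a[of n] by (simp add: abs_mult power_abs)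
  qed
  ultimately show "(\<lambda>k. a k * t ^ k) sums f t"
    by (simp add: sums_iff)
qed

section \<open>Signs of binomial coefficients, and the series of
  \<open>1 - (1 - s) powr \<delta>\<close> and of \<open>arcsin\<close>\<close>

lemma gbinomial_Suc_ratio: "(a gchoose Suc k) = (a gchoose k) * ((a - real k) / (real k + 1))" for a :: real
  using gbinomial_mult_1[of a k] by (simp add: field_simps)

text \<open>These are the coefficients of \<open>(1 - x) powr (-1/2)\<close>, hence of the
  derivative of \<open>arcsin\<close> after substituting \<open>x = t\<^sup>2\<close>. Consecutive
  ones differ by the positive factor \<open>(k + 1/2) / (k + 1)\<close>.\<close>

lemma gbinomial_neg_half_pos: "0 < (-1) ^ k * ((-1/2 :: real) gchoose k)"
proof (induction k)
  case (Suc k)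
  have "(-1) ^ Suc k * ((-1/2 :: real) gchoose Suc k) =
      (-1) ^ k * ((-1/2 :: real) gchoose k) * ((real k + 1/2) / (real k + 1))"
    unfolding gbinomial_Suc_ratio by (simp add: field_simps)
  also have "\<dots> > 0" using Suc by simp
  finally show ?case .
qed simp

text \<open>Of the factors \<open>\<delta>\<close>, \<open>\<delta> - 1\<close>, ...,
  \<open>\<delta> - k\<close> in the numerator, all but the first are negative.\<close>

lemma gbinomial_sign_between_0_1:
  fixes \<delta> :: real
  assumes "0 < \<delta>" "\<delta> < 1"
  shows "0 < (-1) ^ k * (\<delta> gchoose Suc k)"
proof (induction k)
  case (Suc k)
  have "(-1) ^ Suc k * (\<delta> gchoose Suc (Suc k)) =
      (-1) ^ k * (\<delta> gchoose Suc k) * ((real k + 1 - \<delta>) / (real k + 2))"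
    unfolding gbinomial_Suc_ratio[of \<delta> "Suc k"] by (simp add: divide_simps algebra_simps)
  also have "\<dots> > 0" using Suc assms by simp
  finally show ?case .
qed (use assms in simp)

text \<open>The binomial series on the open interval, extended to the endpoints by nonnegativity of
  the coefficients. Strict positivity from degree one on is what later makes the maximizer
  unique.\<close>

lemma one_minus_powr_power_series:
  fixes \<delta> :: real
  assumes \<delta>: "0 < \<delta>" "\<delta> < 1"
  obtains b :: "nat \<Rightarrow> real" where "\<And>k. 0 \<le> b k" and "\<And>k. 1 \<le> k \<Longrightarrow> 0 < b k" and "summable b"
    and "\<And>s. \<bar>s\<bar> \<le> 1 \<Longrightarrow> (\<lambda>k. b k * s ^ k) sums (1 - (1 - s) powr \<delta>)"
proof
  \<comment> \<open>The value at 0 is 0 because the constant 1 cancels the leading term of the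
    binomial series.\<close>
  define b where "b = (\<lambda>k. if k = 0 then 0 else - ((-1) ^ k * (\<delta> gchoose k)))"
  show pos: "0 < b k" if "1 \<le> k" for k
    using gbinomial_sign_between_0_1[OF \<delta>, of "k - 1"] that by (cases k) (auto simp: b_def)
  show nonneg: "0 \<le> b k" for k
    using pos[of k] by (cases "k = 0") (auto simp: b_def)
  have cont: "continuous_on {-1..1} (\<lambda>s. 1 - (1 - s) powr \<delta>)"
    using \<delta> by (intro continuous_intros continuous_on_powr') auto
  have sums: "(\<lambda>k. b k * s ^ k) sums (1 - (1 - s) powr \<delta>)" if "\<bar>s\<bar> < 1" for s
  proof -
    have "(\<lambda>k. (\<delta> gchoose k) * (- s) ^ k) sums (1 + - s) powr \<delta>"
      by (rule gen_binomial_real) (use that in simp)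
    from sums_diff[OF sums_single[of 0 "\<lambda>_. 1::real"] this]
    moreover have "(if k = 0 then 1 else 0) - (\<delta> gchoose k) * (- s) ^ k = b k * s ^ k" for k
      by (auto simp: b_def power_minus[of s])
    ultimately show ?thesis by simp
  qed
  show "summable b"
    using power_series_closed_interval(1)[OF nonneg cont sums] .
  show "(\<lambda>k. b k * s ^ k) sums (1 - (1 - s) powr \<delta>)" if "\<bar>s\<bar> \<le> 1" for s
    using power_series_closed_interval[OF nonneg cont sums] that by auto
qed

text \<open>Termwise integration of the binomial series of
  \<open>(1 - t\<^sup>2) powr (-1/2)\<close>, followed by the extension to the endpoints.\<close>

lemma arcsin_power_series:
  obtains a :: "nat \<Rightarrow> real" where "\<And>k. 0 \<le> a k" and "\<And>k. odd k \<Longrightarrow> 0 < a k" and "summable a"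
    and "\<And>t. \<bar>t\<bar> \<le> 1 \<Longrightarrow> (\<lambda>k. a k * t ^ k) sums arcsin t"
proof
  \<comment> \<open>\<open>c\<close> lists the coefficients of the derivative in powers of
    \<open>t\<close>, with zeros in odd degrees so that the series in \<open>t\<^sup>2\<close> can
    be reindexed; \<open>a\<close> shifts the index by one and divides by the degree.\<close>
  define c where "c = (\<lambda>n. if even n then (-1) ^ (n div 2) * ((-1/2 :: real) gchoose (n div 2)) else 0)"
  define a where "a = (\<lambda>k. if k = 0 then 0 else c (k - 1) / real k)"
  have c: "0 \<le> c n" "even n \<Longrightarrow> 0 < c n" for n
    using gbinomial_neg_half_pos[of "n div 2"] by (auto simp: c_def)
  show nonneg: "0 \<le> a k" and pos: "odd k \<Longrightarrow> 0 < a k" for k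
    using c[of "k - 1"] by (auto simp: a_def elim: oddE)
  have c_sums: "(\<lambda>n. c n * t ^ n) sums ((1 - t\<^sup>2) powr (-1/2))" if "\<bar>t\<bar> < 1" for t :: real
  proof -
    have "t\<^sup>2 < 1" using that by (simp add: abs_square_less_1)
    then have "(\<lambda>n. ((-1/2) gchoose n) * (- t\<^sup>2) ^ n) sums (1 + - t\<^sup>2) powr (-1/2)"
      by (intro gen_binomial_real) simp
    moreover have "((-1/2) gchoose n) * (- t\<^sup>2) ^ n = c (2 * n) * t ^ (2 * n)" for n
      by (auto simp: c_def power_minus[of "t\<^sup>2"] power_mult)
    ultimately have "(\<lambda>n. c (2 * n) * t ^ (2 * n)) sums (1 - t\<^sup>2) powr (-1/2)" by simp
    then show ?thesis
      by (rule sums_mono_reindex[THEN iffD1, rotated 2])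
         (auto simp: strict_mono_def c_def elim!: evenE)
  qed
  define g where "g = (\<lambda>t::real. \<Sum>n. c n / real (Suc n) * t ^ Suc n)"
  have g_deriv: "(g has_real_derivative (1 - t\<^sup>2) powr (-1/2)) (at t)" if "\<bar>t\<bar> < 1" for t
  proof -
    have "(g has_real_derivative (\<Sum>n. c n / real (Suc n) * real (Suc n) * t ^ n)) (at t)"
      unfolding g_def
      by (rule DERIV_power_series'[of 1]) (use that c_sums in \<open>auto simp: sums_iff abs_less_iff simp del: of_nat_Suc\<close>)
    then show ?thesis using c_sums[OF that] by (simp add: sums_iff del: of_nat_Suc)
  qed
  have arcsin_eq: "arcsin t = g t" if "\<bar>t\<bar> < 1" for t
  proof -
    have "arcsin t - g t = arcsin 0 - g 0"
    proof (rule DERIV_isconst3[where f="\<lambda>t. arcsin t - g t" and a="-1" and b=1])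
      fix u :: real assume "u \<in> {-1<..<1}"
      then have u: "-1 < u" "u < 1" "\<bar>u\<bar> < 1" by auto
      then have "u\<^sup>2 < 1" by (simp add: abs_square_less_1)
      then have "inverse (sqrt (1 - u\<^sup>2)) = (1 - u\<^sup>2) powr (-1/2)"
        by (simp add: powr_minus powr_half_sqrt)
      then show "((\<lambda>t. arcsin t - g t) has_real_derivative 0) (at u)"
        using DERIV_diff[OF DERIV_arcsin[OF u(1,2)] g_deriv[OF u(3)]] by simp
    qed (use that in auto)
    then show ?thesis by (simp add: g_def)
  qed
  have sums: "(\<lambda>k. a k * t ^ k) sums arcsin t" if "\<bar>t\<bar> < 1" for t
  proof -
    have "summable (\<lambda>n. c n / real (Suc n) * t ^ Suc n)"
    proof (rule summable_comparison_test')
      show "summable (\<lambda>n. c n * \<bar>t\<bar> ^ n)" using c_sums[of "\<bar>t\<bar>"] that by (simp add: sums_iff)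
      fix n
      have "\<bar>t\<bar> / real (Suc n) \<le> 1" using that by (simp add: field_simps)
      from mult_left_mono[OF this, of "c n * \<bar>t\<bar> ^ n"]
      show "norm (c n / real (Suc n) * t ^ Suc n) \<le> c n * \<bar>t\<bar> ^ n"
        using c(1)[of n] by (simp add: abs_mult power_abs field_simps)
    qed
    then have "(\<lambda>n. a (Suc n) * t ^ Suc n) sums arcsin t"
      by (simp add: arcsin_eq[OF that] g_def a_def summable_sums)
    then show ?thesis
      by (subst (asm) sums_Suc_iff) (simp add: a_def)
  qed
  show "summable a"
    using power_series_closed_interval(1)[OF nonneg continuous_on_arcsin' sums] .
  show "(\<lambda>k. a k * t ^ k) sums arcsin t" if "\<bar>t\<bar> \<le> 1" for t
    using power_series_closed_interval[OF nonneg continuous_on_arcsin' sums] that by auto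
qed

section \<open>Energies of zonal kernels\<close>

lemma
  assumes "\<mu> \<in> sphere_prob_measures"
  shows prob_space_sphere: "prob_space \<mu>"
    and sets_sphere: "sets \<mu> = sets sphere_borel"
    and space_sphere: "space \<mu> = sphere 0 1"
  using assms sets_eq_imp_space_eq[of \<mu> sphere_borel] by (auto simp: sphere_prob_measures_def)

lemma inner_sphere_bounds:
  fixes x y :: "'a::euclidean_space"
  assumes "x \<in> sphere 0 1" "y \<in> sphere 0 1"
  shows "x \<bullet> y \<in> {-1..1}"
  using Cauchy_Schwarz_ineq2[of x y] assms by (auto simp: abs_le_iff)

lemma borel_measurable_sphere:
  assumes "\<mu> \<in> sphere_prob_measures" "continuous_on (sphere 0 1) f"
  shows "f \<in> borel_measurable \<mu>"
proof -
  have "f \<in> borel_measurable sphere_borel"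
    unfolding sphere_borel_def by (rule borel_measurable_continuous_on_restrict[OF assms(2)])
  then show ?thesis by (simp add: measurable_cong_sets[OF sets_sphere[OF assms(1)] refl])
qed

lemma integrable_sphere:
  fixes f :: "'a::euclidean_space \<Rightarrow> real"
  assumes \<mu>: "\<mu> \<in> sphere_prob_measures" and f: "continuous_on (sphere 0 1) f"
  shows "integrable \<mu> f"
proof -
  interpret prob_space \<mu> using \<mu> by (rule prob_space_sphere)
  obtain B where "\<forall>x\<in>sphere 0 1. norm (f x) \<le> B"
    using compact_imp_bounded[OF compact_continuous_image[OF f compact_sphere]]
    by (auto simp: bounded_iff)
  then show ?thesis
    by (intro integrable_const_bound[of _ B] borel_measurable_sphere[OF \<mu> f] AE_I2)
       (simp add: space_sphere[OF \<mu>])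
qed

text \<open>The target is the Borel space restricted to \<open>{-1..1}\<close> because kernels are
  only assumed continuous there.\<close>

lemma inner_measurable_sphere_pair:
  fixes \<mu> \<nu> :: "'a::euclidean_space measure"
  assumes \<mu>: "\<mu> \<in> sphere_prob_measures" and \<nu>: "\<nu> \<in> sphere_prob_measures"
  shows "(\<lambda>z. fst z \<bullet> snd z) \<in> \<mu> \<Otimes>\<^sub>M \<nu> \<rightarrow>\<^sub>M restrict_space borel {-1..1}"
proof (rule measurable_restrict_space2)
  have [measurable]: "(\<lambda>x. x) \<in> borel_measurable \<mu>" "(\<lambda>x. x) \<in> borel_measurable \<nu>"
    by (auto intro: borel_measurable_sphere \<mu> \<nu> continuous_on_id)
  have "fst \<in> borel_measurable (\<mu> \<Otimes>\<^sub>M \<nu>)" "snd \<in> borel_measurable (\<mu> \<Otimes>\<^sub>M \<nu>)"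
    using measurable_compose[OF measurable_fst, of "\<lambda>x. x" \<mu> borel \<nu>]
      measurable_compose[OF measurable_snd, of "\<lambda>x. x" \<nu> borel \<mu>] by simp_all
  then show "(\<lambda>z. fst z \<bullet> snd z) \<in> borel_measurable (\<mu> \<Otimes>\<^sub>M \<nu>)"
    by (rule borel_measurable_inner)
  show "(\<lambda>z. fst z \<bullet> snd z) \<in> space (\<mu> \<Otimes>\<^sub>M \<nu>) \<rightarrow> {-1..1}"
    unfolding space_pair_measure space_sphere[OF \<mu>] space_sphere[OF \<nu>]
    using inner_sphere_bounds by fastforce
qed

lemma measurable_kernel:
  fixes f :: "real \<Rightarrow> real" and \<mu> \<nu> :: "'a::euclidean_space measure"
  assumes "\<mu> \<in> sphere_prob_measures" "\<nu> \<in> sphere_prob_measures" "continuous_on {-1..1} f"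
  shows "(\<lambda>z. f (fst z \<bullet> snd z)) \<in> borel_measurable (\<mu> \<Otimes>\<^sub>M \<nu>)"
  using measurable_compose[OF inner_measurable_sphere_pair[OF assms(1,2)]
      borel_measurable_continuous_on_restrict[OF assms(3)]] .

lemma prob_space_sphere_pair:
  assumes \<mu>: "\<mu> \<in> sphere_prob_measures" and \<nu>: "\<nu> \<in> sphere_prob_measures"
  shows "prob_space (\<mu> \<Otimes>\<^sub>M \<nu>)"
proof -
  interpret M: prob_space \<mu> by (rule prob_space_sphere[OF \<mu>])
  interpret N: prob_space \<nu> by (rule prob_space_sphere[OF \<nu>])
  interpret pair_prob_space \<mu> \<nu> ..
  show ?thesis by (rule P.prob_space_axioms)
qed

lemma integrable_kernel:
  fixes f :: "real \<Rightarrow> real" and \<mu> \<nu> :: "'a::euclidean_space measure"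
  assumes \<mu>: "\<mu> \<in> sphere_prob_measures" and \<nu>: "\<nu> \<in> sphere_prob_measures"
    and f: "continuous_on {-1..1} f"
  shows "integrable (\<mu> \<Otimes>\<^sub>M \<nu>) (\<lambda>z. f (fst z \<bullet> snd z))"
proof -
  interpret prob_space "\<mu> \<Otimes>\<^sub>M \<nu>" by (rule prob_space_sphere_pair[OF \<mu> \<nu>])
  obtain B where "\<forall>t\<in>{-1..1}. norm (f t) \<le> B"
    using compact_imp_bounded[OF compact_continuous_image[OF f compact_Icc]]
    by (auto simp: bounded_iff)
  then show ?thesis
    using measurable_space[OF inner_measurable_sphere_pair[OF \<mu> \<nu>]]
    by (intro integrable_const_bound[of _ B] measurable_kernel[OF \<mu> \<nu> f] AE_I2)
       (auto simp: space_restrict_space)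
qed

text \<open>With the product measure, linearity and dominated convergence are single applications;
  \<open>cross_energy_iterated\<close> recovers the iterated integrals in either order.\<close>

definition cross_energy :: "(real \<Rightarrow> real) \<Rightarrow> 'a::euclidean_space measure \<Rightarrow> 'a measure \<Rightarrow> real" where
  "cross_energy f \<mu> \<nu> = (LINT z|(\<mu> \<Otimes>\<^sub>M \<nu>). f (fst z \<bullet> snd z))"

text \<open>The energy of the signed measure \<open>\<mu> - \<nu>\<close> with respect to the kernel \<open>f (x \<bullet> y)\<close>.\<close>

definition energy_gap :: "(real \<Rightarrow> real) \<Rightarrow> 'a::euclidean_space measure \<Rightarrow> 'a measure \<Rightarrow> real" where
  "energy_gap f \<mu> \<nu> =
     cross_energy f \<mu> \<mu> - cross_energy f \<mu> \<nu> - cross_energy f \<nu> \<mu> + cross_energy f \<nu> \<nu>"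

lemma cross_energy_iterated:
  fixes f :: "real \<Rightarrow> real" and \<mu> \<nu> :: "'a::euclidean_space measure"
  assumes \<mu>: "\<mu> \<in> sphere_prob_measures" and \<nu>: "\<nu> \<in> sphere_prob_measures"
    and f: "continuous_on {-1..1} f"
  shows "cross_energy f \<mu> \<nu> = (LINT y|\<nu>. LINT x|\<mu>. f (x \<bullet> y))"
    and "cross_energy f \<mu> \<nu> = (LINT x|\<mu>. LINT y|\<nu>. f (x \<bullet> y))"
proof -
  interpret M: prob_space \<mu> by (rule prob_space_sphere[OF \<mu>])
  interpret N: prob_space \<nu> by (rule prob_space_sphere[OF \<nu>])
  interpret pair_prob_space \<mu> \<nu> ..
  have i: "integrable (\<mu> \<Otimes>\<^sub>M \<nu>) (case_prod (\<lambda>x y. f (x \<bullet> y)))"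
    using integrable_kernel[OF assms] by (simp add: case_prod_unfold)
  show "cross_energy f \<mu> \<nu> = (LINT y|\<nu>. LINT x|\<mu>. f (x \<bullet> y))"
    using integral_snd[OF i] by (simp add: cross_energy_def case_prod_unfold)
  show "cross_energy f \<mu> \<nu> = (LINT x|\<mu>. LINT y|\<nu>. f (x \<bullet> y))"
    using integral_fst[OF i] by (simp add: cross_energy_def case_prod_unfold)
qed

lemma cross_energy_commute:
  fixes f :: "real \<Rightarrow> real" and \<mu> \<nu> :: "'a::euclidean_space measure"
  assumes "\<mu> \<in> sphere_prob_measures" "\<nu> \<in> sphere_prob_measures" "continuous_on {-1..1} f"
  shows "cross_energy f \<mu> \<nu> = cross_energy f \<nu> \<mu>"
  using cross_energy_iterated[OF assms] cross_energy_iterated[OF assms(2,1,3)]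
  by (simp add: inner_commute)

lemma cross_energy_cong:
  fixes \<mu> \<nu> :: "'a::euclidean_space measure"
  assumes "\<mu> \<in> sphere_prob_measures" "\<nu> \<in> sphere_prob_measures"
    and eq: "\<And>t. t \<in> {-1..1} \<Longrightarrow> f t = g t"
  shows "cross_energy f \<mu> \<nu> = cross_energy g \<mu> \<nu>"
  unfolding cross_energy_def
  using measurable_space[OF inner_measurable_sphere_pair[OF assms(1,2)]]
  by (intro Bochner_Integration.integral_cong refl eq) (auto simp: space_restrict_space)

lemma energy_gap_cong:
  fixes \<mu> \<nu> :: "'a::euclidean_space measure"
  assumes "\<mu> \<in> sphere_prob_measures" "\<nu> \<in> sphere_prob_measures"
    and "\<And>t. t \<in> {-1..1} \<Longrightarrow> f t = g t"
  shows "energy_gap f \<mu> \<nu> = energy_gap g \<mu> \<nu>"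
  unfolding energy_gap_def by (intro arg_cong2[where f="(+)"] arg_cong2[where f="(-)"] cross_energy_cong assms)

text \<open>Both measures have mass one, so constants cancel in the gap and kernels may be shifted
  by them.\<close>

lemma energy_gap_const:
  fixes \<mu> \<nu> :: "'a::euclidean_space measure"
  assumes "\<mu> \<in> sphere_prob_measures" "\<nu> \<in> sphere_prob_measures"
  shows "energy_gap (\<lambda>t. c) \<mu> \<nu> = 0"
  by (simp add: energy_gap_def cross_energy_def prob_space.prob_space prob_space_sphere_pair assms)

lemma energy_gap_add:
  fixes \<mu> \<nu> :: "'a::euclidean_space measure"
  assumes "\<mu> \<in> sphere_prob_measures" "\<nu> \<in> sphere_prob_measures"
    and "continuous_on {-1..1} f" "continuous_on {-1..1} g"
  shows "energy_gap (\<lambda>t. f t + g t) \<mu> \<nu> = energy_gap f \<mu> \<nu> + energy_gap g \<mu> \<nu>"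
  unfolding energy_gap_def cross_energy_def
  by (simp add: integrable_kernel assms)

lemma energy_gap_diff:
  fixes \<mu> \<nu> :: "'a::euclidean_space measure"
  assumes "\<mu> \<in> sphere_prob_measures" "\<nu> \<in> sphere_prob_measures"
    and "continuous_on {-1..1} f" "continuous_on {-1..1} g"
  shows "energy_gap (\<lambda>t. f t - g t) \<mu> \<nu> = energy_gap f \<mu> \<nu> - energy_gap g \<mu> \<nu>"
  unfolding energy_gap_def cross_energy_def
  by (simp add: integrable_kernel assms)

lemma energy_gap_cmult:
  fixes \<mu> \<nu> :: "'a::euclidean_space measure"
  assumes "\<mu> \<in> sphere_prob_measures" "\<nu> \<in> sphere_prob_measures"
  shows "energy_gap (\<lambda>t. c * f t) \<mu> \<nu> = c * energy_gap f \<mu> \<nu>"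
  unfolding energy_gap_def cross_energy_def by (simp add: algebra_simps)

lemma energy_gap_sum:
  fixes \<mu> \<nu> :: "'a::euclidean_space measure"
  assumes "\<mu> \<in> sphere_prob_measures" "\<nu> \<in> sphere_prob_measures"
    and "\<And>k. k \<in> K \<Longrightarrow> continuous_on {-1..1} (h k)"
  shows "energy_gap (\<lambda>t. \<Sum>k\<in>K. h k t) \<mu> \<nu> = (\<Sum>k\<in>K. energy_gap (h k) \<mu> \<nu>)"
  using assms(3)
proof (induction K rule: infinite_finite_induct)
  case (insert k K)
  then show ?case
    using energy_gap_add[OF assms(1,2), of "h k" "\<lambda>t. \<Sum>k\<in>K. h k t"]
    by (simp add: continuous_on_sum)
qed (simp_all add: energy_gap_const[OF assms(1,2)])

lemma cross_energy_tendsto: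
  fixes \<mu> \<nu> :: "'a::euclidean_space measure" and F :: "nat \<Rightarrow> real \<Rightarrow> real"
  assumes \<mu>: "\<mu> \<in> sphere_prob_measures" and \<nu>: "\<nu> \<in> sphere_prob_measures"
    and F: "\<And>n. continuous_on {-1..1} (F n)" and f: "continuous_on {-1..1} f"
    and lim: "\<And>t. t \<in> {-1..1} \<Longrightarrow> (\<lambda>n. F n t) \<longlonglongrightarrow> f t"
    and B: "\<And>n t. t \<in> {-1..1} \<Longrightarrow> \<bar>F n t\<bar> \<le> B"
  shows "(\<lambda>n. cross_energy (F n) \<mu> \<nu>) \<longlonglongrightarrow> cross_energy f \<mu> \<nu>"
  unfolding cross_energy_def
proof (rule integral_dominated_convergence[where w="\<lambda>_. B"])
  interpret prob_space "\<mu> \<Otimes>\<^sub>M \<nu>" by (rule prob_space_sphere_pair[OF \<mu> \<nu>])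
  show "integrable (\<mu> \<Otimes>\<^sub>M \<nu>) (\<lambda>_. B)" by simp
qed (use measurable_space[OF inner_measurable_sphere_pair[OF \<mu> \<nu>]] in
    \<open>auto simp: space_restrict_space intro!: measurable_kernel \<mu> \<nu> F f lim B AE_I2\<close>)

lemma energy_gap_tendsto:
  fixes \<mu> \<nu> :: "'a::euclidean_space measure" and F :: "nat \<Rightarrow> real \<Rightarrow> real"
  assumes "\<mu> \<in> sphere_prob_measures" "\<nu> \<in> sphere_prob_measures"
    and "\<And>n. continuous_on {-1..1} (F n)" "continuous_on {-1..1} f"
    and "\<And>t. t \<in> {-1..1} \<Longrightarrow> (\<lambda>n. F n t) \<longlonglongrightarrow> f t"
    and "\<And>n t. t \<in> {-1..1} \<Longrightarrow> \<bar>F n t\<bar> \<le> B"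
  shows "(\<lambda>n. energy_gap (F n) \<mu> \<nu>) \<longlonglongrightarrow> energy_gap f \<mu> \<nu>"
  unfolding energy_gap_def
  by (intro tendsto_add tendsto_diff cross_energy_tendsto[OF _ _ assms(3-6)] assms(1,2))

text \<open>Dominated convergence, as all partial sums are bounded by \<open>suminf a\<close>. The
  functions \<open>h k\<close> will be the powers of \<open>t\<close> for the arcsine kernel, and
  the powers of \<open>s t\<close> for exponents below one.\<close>

lemma energy_gap_sums:
  fixes \<mu> \<nu> :: "'a::euclidean_space measure" and h :: "nat \<Rightarrow> real \<Rightarrow> real"
  assumes \<mu>\<nu>: "\<mu> \<in> sphere_prob_measures" "\<nu> \<in> sphere_prob_measures"
    and h: "\<And>k. continuous_on {-1..1} (h k)" and f: "continuous_on {-1..1} f"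
    and a: "\<And>k. 0 \<le> a k" "summable a"
    and le: "\<And>k t. t \<in> {-1..1} \<Longrightarrow> \<bar>h k t\<bar> \<le> 1"
    and sums: "\<And>t. t \<in> {-1..1} \<Longrightarrow> (\<lambda>k. a k * h k t) sums f t"
  shows "(\<lambda>k. a k * energy_gap (h k) \<mu> \<nu>) sums energy_gap f \<mu> \<nu>"
proof -
  have "(\<lambda>n. energy_gap (\<lambda>t. \<Sum>k<n. a k * h k t) \<mu> \<nu>) \<longlonglongrightarrow> energy_gap f \<mu> \<nu>"
  proof (rule energy_gap_tendsto[OF \<mu>\<nu> _ f])
    show "\<bar>\<Sum>k<n. a k * h k t\<bar> \<le> suminf a" if t: "t \<in> {-1..1}" for n t
    proof -
      have "\<bar>\<Sum>k<n. a k * h k t\<bar> \<le> (\<Sum>k<n. \<bar>a k * h k t\<bar>)" by (rule sum_abs)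
      also have "\<dots> \<le> (\<Sum>k<n. a k)"
        using mult_left_mono[OF le[OF t] a(1)] a(1) by (intro sum_mono) (simp add: abs_mult)
      also have "\<dots> \<le> suminf a" using a by (intro sum_le_suminf) auto
      finally show ?thesis .
    qed
  qed (use sums in \<open>auto simp: sums_def intro!: continuous_intros h\<close>)
  moreover have "energy_gap (\<lambda>t. \<Sum>k<n. a k * h k t) \<mu> \<nu> = (\<Sum>k<n. a k * energy_gap (h k) \<mu> \<nu>)" for n
    by (subst energy_gap_sum[OF \<mu>\<nu>]) (auto intro!: continuous_intros h simp: energy_gap_cmult[OF \<mu>\<nu>])
  ultimately show ?thesis by (simp add: sums_def)
qed

section \<open>Moments\<close>

text \<open>A list of basis vectors acts as a tensor index: lists of length \<open>m\<close>
  enumerate the coordinates of the \<open>m\<close>-fold tensor power of \<open>x\<close>.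
  Reorderings count separately, which absorbs the multinomial coefficients.\<close>

definition monomial :: "'a list \<Rightarrow> 'a::euclidean_space \<Rightarrow> real" where
  "monomial bs x = (\<Prod>b\<leftarrow>bs. x \<bullet> b)"

lemma monomial_simps [simp]:
  "monomial [] x = 1" "monomial (b # bs) x = (x \<bullet> b) * monomial bs x"
  "monomial (bs @ cs) x = monomial bs x * monomial cs x"
  by (simp_all add: monomial_def)

lemma continuous_on_monomial: "continuous_on A (monomial bs)"
  by (induction bs) (auto simp: monomial_def intro!: continuous_intros)

lemma monomial_minus: "monomial bs (- x) = (-1) ^ length bs * monomial bs x"
  by (induction bs) auto

text \<open>This is the inner product of the tensor powers of \<open>x\<close> and \<open>y\<close>;
  the induction peels off the head of the list as one more coordinate.\<close>

lemma inner_power_eq_sum_monomial: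
  fixes x y :: "'a::euclidean_space"
  shows "(x \<bullet> y) ^ m =
    (\<Sum>bs | set bs \<subseteq> Basis \<and> length bs = m. monomial bs x * monomial bs y)"
proof (induction m)
  case 0
  have "{bs::'a list. set bs \<subseteq> Basis \<and> length bs = 0} = {[]}" by auto
  then show ?case by simp
next
  case (Suc m)
  let ?L = "\<lambda>m. {bs::'a list. set bs \<subseteq> Basis \<and> length bs = m}"
  have "(\<Sum>bs\<in>?L (Suc m). monomial bs x * monomial bs y) =
      (\<Sum>(b, bs)\<in>Basis \<times> ?L m. monomial (b # bs) x * monomial (b # bs) y)"
    by (rule sum.reindex_bij_witness[where i="\<lambda>(b, bs). b # bs" and j="\<lambda>bs. (hd bs, tl bs)"])
       (auto simp: length_Suc_conv)
  also have "\<dots> = (\<Sum>b\<in>Basis. \<Sum>bs\<in>?L m. monomial (b # bs) x * monomial (b # bs) y)"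
    by (simp add: sum.cartesian_product)
  also have "\<dots> = (x \<bullet> y) * (\<Sum>bs\<in>?L m. monomial bs x * monomial bs y)"
    by (subst euclidean_inner) (simp add: sum_product mult_ac)
  finally show ?case using Suc by simp
qed

text \<open>Every summand of the expansion separates the variables, so each cross energy is a sum of
  products of moments, and the four of them combine into squares.\<close>

lemma energy_gap_power:
  fixes \<mu> \<nu> :: "'a::euclidean_space measure"
  assumes \<mu>: "\<mu> \<in> sphere_prob_measures" and \<nu>: "\<nu> \<in> sphere_prob_measures"
  shows "energy_gap (\<lambda>t. t ^ m) \<mu> \<nu> =
    (\<Sum>bs | set bs \<subseteq> Basis \<and> length bs = m.
      ((LINT x|\<mu>. monomial bs x) - (LINT x|\<nu>. monomial bs x))\<^sup>2)"
proof -
  let ?L = "{bs::'a list. set bs \<subseteq> Basis \<and> length bs = m}"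
  have int: "integrable \<alpha> (monomial bs)" if "\<alpha> \<in> sphere_prob_measures" for \<alpha> and bs :: "'a list"
    using integrable_sphere[OF that continuous_on_monomial] .
  have "cross_energy (\<lambda>t. t ^ m) \<alpha> \<beta> =
      (\<Sum>bs\<in>?L. (LINT x|\<alpha>. monomial bs x) * (LINT x|\<beta>. monomial bs x))"
    if "\<alpha> \<in> sphere_prob_measures" "\<beta> \<in> sphere_prob_measures" for \<alpha> \<beta>
    by (subst cross_energy_iterated(1))
       (simp_all add: that int inner_power_eq_sum_monomial continuous_intros)
  then show ?thesis
    by (simp add: energy_gap_def \<mu> \<nu> sum_subtractf[symmetric] sum.distrib[symmetric]
        power2_eq_square algebra_simps)
qed

lemma energy_gap_power_nonneg:
  fixes \<mu> \<nu> :: "'a::euclidean_space measure"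
  assumes "\<mu> \<in> sphere_prob_measures" "\<nu> \<in> sphere_prob_measures"
  shows "0 \<le> energy_gap (\<lambda>t. t ^ m) \<mu> \<nu>"
  unfolding energy_gap_power[OF assms] by (intro sum_nonneg) simp

lemma energy_gap_power_eq_0_imp:
  fixes \<mu> \<nu> :: "'a::euclidean_space measure"
  assumes "\<mu> \<in> sphere_prob_measures" "\<nu> \<in> sphere_prob_measures"
    and "energy_gap (\<lambda>t. t ^ m) \<mu> \<nu> = 0" and "set bs \<subseteq> Basis" "length bs = m"
  shows "(LINT x|\<mu>. monomial bs x) = (LINT x|\<nu>. monomial bs x)"
proof -
  have "finite {bs::'a list. set bs \<subseteq> Basis \<and> length bs = m}"
    by (rule finite_lists_length_eq) simp
  with assms(3-5) show ?thesis
    unfolding energy_gap_power[OF assms(1,2)] by (subst (asm) sum_nonneg_eq_0_iff) auto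
qed

text \<open>Relatively closed sets form an intersection-stable generator of the Borel sets of the
  sphere, and their measures are limits of integrals of continuous functions.\<close>

lemma measure_eq_if_integral_continuous_eq:
  fixes \<mu> \<nu> :: "'a::euclidean_space measure"
  assumes \<mu>: "\<mu> \<in> sphere_prob_measures" and \<nu>: "\<nu> \<in> sphere_prob_measures"
    and eq: "\<And>f :: 'a \<Rightarrow> real. continuous_on UNIV f \<Longrightarrow> (LINT x|\<mu>. f x) = (LINT x|\<nu>. f x)"
  shows "\<mu> = \<nu>"
proof (rule measure_eqI_generator_eq)
  interpret M: prob_space \<mu> by (rule prob_space_sphere[OF \<mu>])
  interpret N: prob_space \<nu> by (rule prob_space_sphere[OF \<nu>])
  let ?S = "sphere (0::'a) 1" and ?E = "(\<lambda>C. sphere 0 1 \<inter> C) ` Collect (closed :: 'a set \<Rightarrow> bool)"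
  show "Int_stable ?E"
  proof (rule Int_stableI)
    fix a b assume "a \<in> ?E" "b \<in> ?E"
    then obtain C D where "closed C" "closed D" "a = ?S \<inter> C" "b = ?S \<inter> D" by auto
    then show "a \<inter> b \<in> ?E" by (intro image_eqI[of _ _ "C \<inter> D"]) auto
  qed
  show "?E \<subseteq> Pow ?S" by auto
  have "sets (restrict_space borel ?S) = sigma_sets ?S ?E"
    unfolding borel_eq_closed by (subst sets_restrict_space) (auto simp: sigma_sets_Int)
  then show "sets \<mu> = sigma_sets ?S ?E" "sets \<nu> = sigma_sets ?S ?E"
    by (simp_all add: sets_sphere[OF \<mu>] sets_sphere[OF \<nu>] sphere_borel_def)
  show "range (\<lambda>_. ?S) \<subseteq> ?E" by (auto intro!: image_eqI[of _ _ UNIV])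
  show "(\<Union>i::nat. ?S) = ?S" by simp
  show "emeasure \<mu> ?S \<noteq> \<infinity>" by simp
  \<comment> \<open>These continuous functions equal 1 on \<open>C\<close>; at a point outside they
    are eventually 0, since a nonempty closed set has positive distance from it.\<close>
  have approx: "(\<lambda>n. LINT x|\<alpha>. max 0 (1 - real n * infdist x C)) \<longlonglongrightarrow> measure \<alpha> (?S \<inter> C)"
    if \<alpha>: "\<alpha> \<in> sphere_prob_measures" and C: "closed C" "C \<noteq> {}" for \<alpha> and C :: "'a set"
  proof -
    interpret prob_space \<alpha> by (rule prob_space_sphere[OF \<alpha>])
    have "?S \<inter> C \<in> sets sphere_borel"
      using C by (auto simp: sphere_borel_def sets_restrict_space)
    then have SC: "?S \<inter> C \<in> sets \<alpha>" by (simp add: sets_sphere[OF \<alpha>])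
    have "(\<lambda>n. LINT x|\<alpha>. max 0 (1 - real n * infdist x C)) \<longlonglongrightarrow> (LINT x|\<alpha>. indicator (?S \<inter> C) x)"
    proof (rule integral_dominated_convergence[where w="\<lambda>_. 1"])
      show "AE x in \<alpha>. (\<lambda>n. max 0 (1 - real n * infdist x C)) \<longlonglongrightarrow> indicator (?S \<inter> C) x"
      proof (rule AE_I2)
        fix x assume x: "x \<in> space \<alpha>"
        show "(\<lambda>n. max 0 (1 - real n * infdist x C)) \<longlonglongrightarrow> indicator (?S \<inter> C) x"
        proof (cases "x \<in> C")
          case True
          with x C show ?thesis by (simp add: space_sphere[OF \<alpha>])
        next
          case False
          then have "0 < infdist x C" using C infdist_pos_not_in_closed by blast
          then obtain N where "1 < real N * infdist x C"
            using ex_less_of_nat_mult by blast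
          moreover have "real N * infdist x C \<le> real n * infdist x C" if "N \<le> n" for n
            using that by (intro mult_right_mono) (auto simp: infdist_nonneg)
          ultimately have "\<forall>n\<ge>N. max 0 (1 - real n * infdist x C) = 0"
            by (fastforce simp: max_def)
          with False show ?thesis
            by (intro tendsto_eventually) (auto simp: eventually_sequentially intro!: exI[of _ N])
        qed
      qed
    qed (use SC in \<open>auto intro!: borel_measurable_sphere[OF \<alpha>] continuous_intros simp: infdist_nonneg\<close>)
    then show ?thesis using SC by simp
  qed
  fix X assume "X \<in> ?E"
  then obtain C where C: "closed C" "X = ?S \<inter> C" by auto
  \<comment> \<open>By convention \<open>infdist x {} = 0\<close>, so the approximating functions
    would be constantly 1 for the empty set, which is therefore treated apart.\<close>
  show "emeasure \<mu> X = emeasure \<nu> X"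
  proof (cases "C = {}")
    case False
    have "(LINT x|\<mu>. max 0 (1 - real n * infdist x C)) = (LINT x|\<nu>. max 0 (1 - real n * infdist x C))" for n
      by (rule eq) (intro continuous_intros)
    then have "measure \<mu> X = measure \<nu> X"
      using approx[OF \<mu> C(1) False] approx[OF \<nu> C(1) False] C(2) by (auto dest: LIMSEQ_unique)
    then show ?thesis by (simp add: M.emeasure_eq_measure N.emeasure_eq_measure)
  qed (use C in simp)
qed

text \<open>The linear span as an inductive predicate: one scaled monomial is added at a time, so
  whatever holds for monomials and passes to linear combinations follows by rule induction.\<close>

inductive monomial_span :: "('a::euclidean_space \<Rightarrow> real) \<Rightarrow> bool" where
  zero: "monomial_span (\<lambda>x. 0)"
| add_monomial: "monomial_span f \<Longrightarrow> set bs \<subseteq> Basis \<Longrightarrow> monomial_span (\<lambda>x. c * monomial bs x + f x)"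

lemma monomial_span_add: "monomial_span f \<Longrightarrow> monomial_span g \<Longrightarrow> monomial_span (\<lambda>x. f x + g x)"
  by (induction rule: monomial_span.induct) (auto simp: add.assoc intro: monomial_span.intros)

lemma monomial_span_monomial: "set bs \<subseteq> Basis \<Longrightarrow> monomial_span (\<lambda>x. c * monomial bs x)"
  using monomial_span.add_monomial[OF monomial_span.zero] by simp

lemma monomial_span_times_monomial:
  "monomial_span f \<Longrightarrow> set bs \<subseteq> Basis \<Longrightarrow> monomial_span (\<lambda>x. c * monomial bs x * f x)"
proof (induction rule: monomial_span.induct)
  case (add_monomial f cs e)
  then show ?case
    using monomial_span.add_monomial[of "\<lambda>x. c * monomial bs x * f x" "bs @ cs" "c * e"]
    by (simp add: algebra_simps)
qed (simp add: monomial_span.zero)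

lemma monomial_span_mult: "monomial_span f \<Longrightarrow> monomial_span g \<Longrightarrow> monomial_span (\<lambda>x. f x * g x)"
proof (induction rule: monomial_span.induct)
  case (add_monomial f bs c)
  then show ?case
    using monomial_span_add[OF monomial_span_times_monomial[of g bs c]]
    by (simp add: distrib_right)
qed (simp add: monomial_span.zero)

lemma monomial_span_sum:
  "(\<And>i. i \<in> I \<Longrightarrow> monomial_span (f i)) \<Longrightarrow> monomial_span (\<lambda>x. \<Sum>i\<in>I. f i x)"
  by (induction I rule: infinite_finite_induct) (auto intro: monomial_span.zero monomial_span_add)

text \<open>Links to the Stone-Weierstrass theorem, whose polynomial functions are generated by
  constants and bounded linear functionals; a functional expands in the basis into monomials of
  degree one.\<close>

lemma real_polynomial_function_monomial_span:
  fixes f :: "'a::euclidean_space \<Rightarrow> real"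
  assumes "real_polynomial_function f"
  shows "monomial_span f"
  using assms
proof (induction rule: real_polynomial_function.induct)
  case (linear f)
  then interpret bounded_linear f .
  have "f x = (\<Sum>b\<in>Basis. f b * monomial [b] x)" for x
    by (subst euclidean_representation[of x, symmetric]) (simp add: sum scaleR mult.commute)
  then have "f = (\<lambda>x. \<Sum>b\<in>Basis. f b * monomial [b] x)" by blast
  moreover have "monomial_span (\<lambda>x. \<Sum>b\<in>Basis. f b * monomial [b] x)"
    by (intro monomial_span_sum monomial_span_monomial) simp
  ultimately show ?case by simp
next
  case (const c)
  show ?case using monomial_span_monomial[of "[]" c] by simp
qed (auto intro: monomial_span_add monomial_span_mult)

text \<open>On the compact sphere every continuous function is a uniform limit of polynomials, whose
  integrals are fixed by the moments.\<close>

lemma measure_eq_if_moments_eq: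
  fixes \<mu> \<nu> :: "'a::euclidean_space measure"
  assumes \<mu>: "\<mu> \<in> sphere_prob_measures" and \<nu>: "\<nu> \<in> sphere_prob_measures"
    and eq: "\<And>bs. set bs \<subseteq> Basis \<Longrightarrow> (LINT x|\<mu>. monomial bs x) = (LINT x|\<nu>. monomial bs x)"
  shows "\<mu> = \<nu>"
proof (rule measure_eq_if_integral_continuous_eq[OF \<mu> \<nu>])
  interpret M: prob_space \<mu> by (rule prob_space_sphere[OF \<mu>])
  interpret N: prob_space \<nu> by (rule prob_space_sphere[OF \<nu>])
  have span: "continuous_on UNIV g \<and> (LINT x|\<mu>. g x) = (LINT x|\<nu>. g x)"
    if "monomial_span g" for g :: "'a \<Rightarrow> real"
    using that
  proof (induction rule: monomial_span.induct)
    case (add_monomial f bs c)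
    have "integrable \<alpha> (monomial bs)" "integrable \<alpha> f" if "\<alpha> \<in> sphere_prob_measures" for \<alpha>
      using add_monomial continuous_on_subset[of UNIV f "sphere 0 1"]
      by (auto intro!: integrable_sphere[OF that] continuous_on_monomial)
    with add_monomial \<mu> \<nu> eq show ?case
      by (auto intro!: continuous_intros continuous_on_monomial)
  qed auto
  fix f :: "'a \<Rightarrow> real" assume f: "continuous_on UNIV f"
  then have fS: "continuous_on (sphere 0 1) f" by (rule continuous_on_subset) simp
  have "\<bar>(LINT x|\<mu>. f x) - (LINT x|\<nu>. f x)\<bar> \<le> e" if e: "0 < e" for e
  proof -
    obtain g where g: "real_polynomial_function g" "\<And>x. x \<in> sphere 0 1 \<Longrightarrow> \<bar>f x - g x\<bar> < e / 2"
      using Stone_Weierstrass_real_polynomial_function[OF compact_sphere fS, of "e / 2"] e by auto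
    note gspan = span[OF real_polynomial_function_monomial_span[OF g(1)]]
    then have gS: "continuous_on (sphere 0 1) g" using continuous_on_subset by blast
    have near: "\<bar>(LINT x|\<alpha>. f x) - (LINT x|\<alpha>. g x)\<bar> \<le> e / 2" if \<alpha>: "\<alpha> \<in> sphere_prob_measures" for \<alpha>
    proof -
      interpret prob_space \<alpha> by (rule prob_space_sphere[OF \<alpha>])
      have "\<bar>(LINT x|\<alpha>. f x) - (LINT x|\<alpha>. g x)\<bar> = \<bar>LINT x|\<alpha>. f x - g x\<bar>"
        using integrable_sphere[OF \<alpha> fS] integrable_sphere[OF \<alpha> gS] by simp
      also have "\<dots> \<le> (LINT x|\<alpha>. \<bar>f x - g x\<bar>)" by (rule integral_abs_bound)
      also have "\<dots> \<le> (LINT x|\<alpha>. e / 2)"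
        using g(2) fS gS
        by (intro integral_mono integrable_sphere[OF \<alpha>] continuous_intros)
           (auto simp: space_sphere[OF \<alpha>] intro!: less_imp_le)
      finally show ?thesis by (simp add: prob_space)
    qed
    show ?thesis using near[OF \<mu>] near[OF \<nu>] gspan by linarith
  qed
  then have "\<bar>(LINT x|\<mu>. f x) - (LINT x|\<nu>. f x)\<bar> \<le> 0"
    by (rule field_le_epsilon[of _ 0, simplified])
  then show "(LINT x|\<mu>. f x) = (LINT x|\<nu>. f x)" by simp
qed

section \<open>Invariance of the surface measure\<close>

text \<open>For a translation-invariant \<open>M\<close>, Fubini's theorem and the symmetry of the unit ball \<open>B\<close> give
  \<open>lborel A * M B = \<integral>\<integral> 1\<^sub>A (x + y) * 1\<^sub>B y \<partial>lborel x \<partial>M y =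
  \<integral>\<integral> 1\<^sub>A y * 1\<^sub>B (y - x) \<partial>M y \<partial>lborel x = M A * lborel B\<close>.\<close>

lemma translation_invariant_eq_lborel:
  fixes M :: "'a::euclidean_space measure"
  assumes [measurable_cong]: "sets M = sets borel" and "sigma_finite_measure M"
    and inv: "\<And>v. distr M borel ((+) v) = M"
    and ball: "emeasure M (ball 0 1) = emeasure lborel (ball (0::'a) 1)"
  shows "M = lborel"
proof (rule measure_eqI)
  interpret M: sigma_finite_measure M by fact
  interpret pair_sigma_finite "lborel :: 'a measure" M ..
  let ?B = "ball (0::'a) 1"
  have [measurable]: "?B \<in> sets borel" by simp
  have cong: "borel_measurable (lborel \<Otimes>\<^sub>M M) = borel_measurable (borel \<Otimes>\<^sub>M borel)"
    by (intro measurable_cong_sets sets_pair_measure_cong) (auto simp: assms(1))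
  fix A assume "A \<in> sets M"
  then have A [measurable]: "A \<in> sets borel" by (simp add: assms(1))
  have "emeasure lborel A * emeasure M ?B = (\<integral>\<^sup>+y. (\<integral>\<^sup>+x. indicator A x \<partial>lborel) * indicator ?B y \<partial>M)"
    by (subst nn_integral_cmult) (auto simp: assms(1) borel_measurable_indicator_iff)
  also have "\<dots> = (\<integral>\<^sup>+y. (\<integral>\<^sup>+x. indicator A (y + x) \<partial>lborel) * indicator ?B y \<partial>M)"
  proof -
    have "(\<integral>\<^sup>+x. indicator A x \<partial>lborel) = (\<integral>\<^sup>+x. indicator A (y + x) \<partial>lborel)" for y :: 'a
      using nn_integral_distr[of "(+) y" lborel borel "indicator A"] by (simp add: lborel_distr_plus)
    then show ?thesis by metis
  qed
  also have "\<dots> = (\<integral>\<^sup>+y. (\<integral>\<^sup>+x. indicator A (y + x) * indicator ?B y \<partial>lborel) \<partial>M)"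
    by (simp add: nn_integral_multc)
  also have "\<dots> = (\<integral>\<^sup>+x. (\<integral>\<^sup>+y. indicator A (y + x) * indicator ?B y \<partial>M) \<partial>lborel)"
    by (rule Fubini') (simp only: cong, measurable)
  also have "\<dots> = (\<integral>\<^sup>+x. (\<integral>\<^sup>+y. indicator A y * indicator ?B (y - x) \<partial>M) \<partial>lborel)"
  proof (rule nn_integral_cong)
    fix x :: 'a
    have "(+) x \<in> M \<rightarrow>\<^sub>M borel" "(\<lambda>y. indicator A y * indicator ?B (y - x) :: ennreal) \<in> M \<rightarrow>\<^sub>M borel"
      by (simp_all add: measurable_cong_sets[OF assms(1) refl])
    then show "(\<integral>\<^sup>+y. indicator A (y + x) * indicator ?B y \<partial>M) =
        (\<integral>\<^sup>+y. indicator A y * indicator ?B (y - x) \<partial>M)"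
      using nn_integral_distr[of "(+) x" M borel "\<lambda>y. indicator A y * indicator ?B (y - x)"]
      by (simp add: inv add.commute)
  qed
  also have "\<dots> = (\<integral>\<^sup>+y. (\<integral>\<^sup>+x. indicator A y * indicator ?B (y - x) \<partial>lborel) \<partial>M)"
    by (rule Fubini'[symmetric]) (simp only: cong, measurable)
  also have "\<dots> = (\<integral>\<^sup>+y. indicator A y * emeasure lborel ?B \<partial>M)"
  proof (rule nn_integral_cong)
    fix y :: 'a
    have "(\<integral>\<^sup>+x. indicator A y * indicator ?B (y - x) \<partial>lborel) =
        indicator A y * (\<integral>\<^sup>+x. indicator ?B (y - x) \<partial>lborel)"
      by (rule nn_integral_cmult) measurable
    also have "(\<integral>\<^sup>+x. indicator ?B (y - x) \<partial>lborel) = (\<integral>\<^sup>+x. indicator (ball y 1) x \<partial>(lborel :: 'a measure))"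
      by (intro nn_integral_cong) (auto simp: indicator_def dist_norm norm_minus_commute)
    also have "\<dots> = emeasure lborel ?B" by (simp add: emeasure_ball)
    finally show "(\<integral>\<^sup>+x. indicator A y * indicator ?B (y - x) \<partial>lborel) =
        indicator A y * emeasure lborel ?B" .
  qed
  also have "\<dots> = emeasure M A * emeasure lborel ?B"
    by (subst nn_integral_multc) (auto simp: assms(1) borel_measurable_indicator_iff)
  finally have "emeasure lborel ?B * emeasure M A = emeasure lborel ?B * emeasure lborel A"
    by (simp add: ball mult.commute)
  moreover have "unit_ball_vol (real DIM('a)) \<noteq> 0"
    using unit_ball_vol_pos[of "real DIM('a)"] by linarith
  then have "emeasure lborel ?B \<noteq> 0" "emeasure lborel ?B \<noteq> \<infinity>"
    by (auto simp: emeasure_ball)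
  ultimately show "emeasure M A = emeasure lborel A"
    by (simp add: ennreal_mult_cancel_left)
qed (simp add: assms(1))

text \<open>The pushforward is translation-invariant, as translating by \<open>v\<close> after
  \<open>T\<close> amounts to translating by \<open>inv T v\<close> before it, and it keeps the
  volume of the unit ball because \<open>T\<close> preserves norms.\<close>

lemma lborel_distr_orthogonal_transformation:
  fixes T :: "'a::euclidean_space \<Rightarrow> 'a"
  assumes T: "orthogonal_transformation T"
  shows "distr lborel borel T = lborel"
proof (rule translation_invariant_eq_lborel)
  have lin: "linear T" and nrm: "\<And>x. norm (T x) = norm x" and bij: "bij T"
    using T by (auto simp: orthogonal_transformation_linear orthogonal_transformation_norm
        orthogonal_transformation_bij)
  have inv: "T (inv T x) = x" "inv T (T x) = x" for x
    using bij by (auto simp: bij_def surj_f_inv_f)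
  have [measurable]: "T \<in> borel \<rightarrow>\<^sub>M borel" "inv T \<in> borel \<rightarrow>\<^sub>M borel"
    using lin orthogonal_transformation_linear[OF orthogonal_transformation_inv[OF T]]
    by (auto intro!: borel_measurable_continuous_onI linear_continuous_on linear_linear[THEN iffD2]
        simp: linear_conv_bounded_linear)
  \<comment> \<open>Pushing forward once more, by \<open>inv T\<close>, returns
    \<open>lborel\<close>, whose sigma-finiteness pulls back.\<close>
  show "sigma_finite_measure (distr lborel borel T)"
  proof (rule sigma_finite_measure_distr)
    show "inv T \<in> distr lborel borel T \<rightarrow>\<^sub>M borel" by simp
    show "sigma_finite_measure (distr (distr lborel borel T) borel (inv T))"
      by (simp add: distr_distr comp_def inv distr_id2 lborel.sigma_finite_measure_axioms)
  qed
  show "distr (distr lborel borel T) borel ((+) v) = distr lborel borel T" for v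
  proof -
    have "(+) v \<circ> T = T \<circ> (+) (inv T v)"
      using lin by (auto simp: linear_add inv)
    then have "distr (distr lborel borel T) borel ((+) v) = distr (distr lborel borel ((+) (inv T v))) borel T"
      by (simp add: distr_distr)
    then show ?thesis by (simp only: lborel_distr_plus)
  qed
  have "T -` ball 0 1 = ball 0 1" by (auto simp: nrm)
  then show "emeasure (distr lborel borel T) (ball 0 1) = emeasure lborel (ball (0::'a) 1)"
    by (simp add: emeasure_distr)
qed simp

text \<open>Radial projection commutes with \<open>T\<close>, so the cone over the preimage of
  \<open>E\<close> is the preimage of the cone over \<open>E\<close>, and Lebesgue measure is
  invariant under \<open>T\<close>.\<close>

lemma sphere_sigma_distr_orthogonal_transformation:
  fixes T :: "'a::euclidean_space \<Rightarrow> 'a"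
  assumes T: "orthogonal_transformation T"
  shows "T \<in> sphere_borel \<rightarrow>\<^sub>M sphere_borel" and "distr sphere_sigma sphere_borel T = sphere_sigma"
proof -
  have lin: "linear T" and nrm: "\<And>x. norm (T x) = norm x"
    using T by (auto simp: orthogonal_transformation_linear orthogonal_transformation_norm)
  have [measurable]: "T \<in> borel \<rightarrow>\<^sub>M borel"
    using lin by (auto intro!: borel_measurable_continuous_onI linear_continuous_on
        simp: linear_conv_bounded_linear)
  show meas: "T \<in> sphere_borel \<rightarrow>\<^sub>M sphere_borel"
    unfolding sphere_borel_def
    by (rule measurable_restrict_space3) (auto simp: nrm)
  let ?S = "sphere (0::'a) 1" and ?f = "\<lambda>x::'a. x /\<^sub>R norm x" and ?B = "cball 0 1 - {0::'a}"
  have surface: "emeasure sphere_surface E = of_nat DIM('a) * emeasure lborel (?f -` E \<inter> ?B)"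
    and cone: "?f -` E \<inter> ?B \<in> sets borel"
    if E: "E \<in> sets sphere_borel" for E
  proof -
    have "?f -` E \<inter> ?B \<in> sets (restrict_space lborel ?B)"
      using measurable_sets[OF radial_projection_measurable E] by (simp add: space_restrict_space)
    then show "?f -` E \<inter> ?B \<in> sets borel"
      by (auto simp: sets_restrict_space)
    show "emeasure sphere_surface E = of_nat DIM('a) * emeasure lborel (?f -` E \<inter> ?B)"
      using E radial_projection_measurable[where 'a='a]
      by (simp add: sphere_surface_def emeasure_distr space_restrict_space emeasure_restrict_space)
  qed
  show "distr sphere_sigma sphere_borel T = sphere_sigma"
  proof (rule measure_eqI)
    fix E assume "E \<in> sets (distr sphere_sigma sphere_borel T)"
    then have E: "E \<in> sets sphere_borel" by simp
    let ?E = "T -` E \<inter> ?S"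
    have E': "?E \<in> sets sphere_borel"
      using measurable_sets[OF meas E] by simp
    have S: "?S \<in> sets sphere_borel" using sets.top[of sphere_borel] by simp
    have "T (?f x) = ?f (T x)" for x by (simp add: linear_cmul[OF lin] nrm)
    moreover have "T x = 0 \<longleftrightarrow> x = 0" for x by (metis nrm norm_eq_zero)
    ultimately have "?f -` ?E \<inter> ?B = T -` (?f -` E \<inter> ?B)" by (auto simp: nrm)
    then have "emeasure lborel (?f -` ?E \<inter> ?B) = emeasure (distr lborel borel T) (?f -` E \<inter> ?B)"
      using cone[OF E] by (simp add: emeasure_distr)
    then have "emeasure sphere_surface ?E = emeasure sphere_surface E"
      by (simp add: surface E E' lborel_distr_orthogonal_transformation[OF T])
    moreover have "?S \<inter> E = E" "?S \<inter> ?E = ?E"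
      using sets.sets_into_space[OF E] by auto
    moreover have "emeasure (distr sphere_sigma sphere_borel T) E = emeasure sphere_sigma ?E"
      using meas E sets_eq_imp_space_eq[OF sets_sphere_sigma[where 'a='a]]
      by (simp add: emeasure_distr cong: measurable_cong_sets)
    ultimately show "emeasure (distr sphere_sigma sphere_borel T) E = emeasure sphere_sigma E"
      using E E' S by (simp add: sphere_sigma_def)
  qed simp
qed

text \<open>Orthogonal maps act transitively on the sphere and preserve \<open>sphere_sigma\<close>;
  substitute one that carries \<open>y\<close> to \<open>z\<close>.\<close>

lemma sphere_sigma_potential_const:
  fixes y z :: "real ^ 'n" and f :: "real \<Rightarrow> real"
  assumes y: "y \<in> sphere 0 1" and z: "z \<in> sphere 0 1"
    and f: "continuous_on {-1..1} f"
  shows "(LINT x|sphere_sigma. f (x \<bullet> y)) = (LINT x|sphere_sigma. f (x \<bullet> z))"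
proof -
  obtain T where T: "orthogonal_transformation T" "T y = z"
    using orthogonal_transformation_exists[of y z] y z by auto
  have "continuous_on (sphere 0 1) (\<lambda>x. f (x \<bullet> z))"
    using inner_sphere_bounds[OF _ z]
    by (intro continuous_on_compose2[OF f]) (auto intro!: continuous_intros simp del: mem_sphere)
  then have meas_f: "(\<lambda>x. f (x \<bullet> z)) \<in> borel_measurable sphere_borel"
    unfolding sphere_borel_def by (rule borel_measurable_continuous_on_restrict)
  have meas_T: "T \<in> sphere_sigma \<rightarrow>\<^sub>M sphere_borel"
    using sphere_sigma_distr_orthogonal_transformation(1)[OF T(1)]
    by (simp cong: measurable_cong_sets)
  have "(LINT x|distr sphere_sigma sphere_borel T. f (x \<bullet> z)) = (LINT x|sphere_sigma. f (T x \<bullet> z))"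
    by (rule integral_distr[OF meas_T meas_f])
  also have "\<dots> = (LINT x|sphere_sigma. f (x \<bullet> y))"
    using T by (simp add: orthogonal_transformation_def flip: T(2))
  finally show ?thesis
    by (simp add: sphere_sigma_distr_orthogonal_transformation(2)[OF T(1)])
qed

section \<open>Exponents below one\<close>

definition dist_kernel :: "real \<Rightarrow> real \<Rightarrow> real" where
  "dist_kernel \<delta> t = (arccos t / pi) powr \<delta>"

lemma continuous_on_dist_kernel: "0 < \<delta> \<Longrightarrow> continuous_on {-1..1} (dist_kernel \<delta>)"
  unfolding dist_kernel_def
  by (intro continuous_on_powr' continuous_intros) (auto simp: arccos_lbound)

lemma geo_energy_eq_cross_energy:
  assumes "\<mu> \<in> sphere_prob_measures" "0 < \<delta>"
  shows "geo_energy \<delta> \<mu> = cross_energy (dist_kernel \<delta>) \<mu> \<mu>"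
  unfolding cross_energy_iterated(1)[OF assms(1,1) continuous_on_dist_kernel[OF assms(2)]]
  by (simp add: geo_energy_def geo_dist_def dist_kernel_def)

section \<open>Polynomial kernels with nonnegative coefficients\<close>

lemma energy_gap_poly_nonneg:
  fixes \<mu> \<nu> :: "'a::euclidean_space measure"
  assumes \<mu>\<nu>: "\<mu> \<in> sphere_prob_measures" "\<nu> \<in> sphere_prob_measures"
    and p: "\<And>i. 0 \<le> coeff p i"
  shows "0 \<le> energy_gap (poly p) \<mu> \<nu>"
proof -
  have "energy_gap (poly p) \<mu> \<nu> = energy_gap (\<lambda>t. \<Sum>i\<le>degree p. coeff p i * t ^ i) \<mu> \<nu>"
    by (simp add: poly_altdef[abs_def])
  also have "\<dots> = (\<Sum>i\<le>degree p. coeff p i * energy_gap (\<lambda>t. t ^ i) \<mu> \<nu>)"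
    by (subst energy_gap_sum[OF \<mu>\<nu>]) (auto intro!: continuous_intros simp: energy_gap_cmult[OF \<mu>\<nu>])
  also have "\<dots> \<ge> 0"
    using p energy_gap_power_nonneg[OF \<mu>\<nu>] by (intro sum_nonneg) simp
  finally show ?thesis .
qed

lemma coeff_mult_nonneg:
  fixes p q :: "real poly"
  assumes "\<And>i. 0 \<le> coeff p i" "\<And>i. 0 \<le> coeff q i"
  shows "0 \<le> coeff (p * q) i"
  using assms by (auto simp: coeff_mult intro!: sum_nonneg)

lemma coeff_power_nonneg:
  fixes p :: "real poly"
  assumes "\<And>i. 0 \<le> coeff p i"
  shows "0 \<le> coeff (p ^ k) i"
proof (induction k arbitrary: i)
  case (Suc k)
  then show ?case using coeff_mult_nonneg[OF assms, of "p ^ k"] by simp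
qed simp

text \<open>Subtracting \<open>q ^ k\<close> removes one term from an expansion into terms with
  nonnegative coefficients. Splitting off one factor in the induction replaces the binomial
  sum.\<close>

lemma coeff_power_diff_nonneg:
  fixes p q :: "real poly"
  assumes p: "\<And>i. 0 \<le> coeff p i" and q: "\<And>i. 0 \<le> coeff q i"
  shows "0 \<le> coeff ((p + q) ^ k - q ^ k) i"
proof (induction k arbitrary: i)
  case (Suc k)
  have "(p + q) ^ Suc k - q ^ Suc k = (p + q) * ((p + q) ^ k - q ^ k) + p * q ^ k"
    by (simp add: algebra_simps)
  then show ?case
    using coeff_mult_nonneg[of "p + q" "(p + q) ^ k - q ^ k" i] Suc
      coeff_mult_nonneg[of p "q ^ k" i] coeff_power_nonneg[of q k] p q
    by (simp only: coeff_add) (intro add_nonneg_nonneg; simp)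
qed simp

text \<open>The power series of \<open>s ^ k\<close> has nonnegative coefficients, and the coefficient of \<open>t ^ k\<close> is at
  least \<open>a 1 ^ k\<close>; truncating \<open>s\<close> to polynomials avoids computing with Cauchy products.\<close>

lemma energy_gap_power_of_series_ge:
  fixes \<mu> \<nu> :: "'a::euclidean_space measure" and a :: "nat \<Rightarrow> real"
  assumes \<mu>\<nu>: "\<mu> \<in> sphere_prob_measures" "\<nu> \<in> sphere_prob_measures"
    and a: "\<And>j. 0 \<le> a j" and s: "continuous_on {-1..1} s"
    and sums: "\<And>t. \<bar>t\<bar> \<le> 1 \<Longrightarrow> (\<lambda>j. a j * t ^ j) sums s t"
  shows "a 1 ^ k * energy_gap (\<lambda>t. t ^ k) \<mu> \<nu> \<le> energy_gap (\<lambda>t. s t ^ k) \<mu> \<nu>"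
proof -
  define p where "p = (\<lambda>N. \<Sum>j<N. monom (a j) j)"
  have poly_p: "poly (p N) t = (\<Sum>j<N. a j * t ^ j)" for N t
    by (simp add: p_def poly_sum poly_monom)
  have "(\<lambda>N. energy_gap (\<lambda>t. poly (p N) t ^ k) \<mu> \<nu>) \<longlonglongrightarrow> energy_gap (\<lambda>t. s t ^ k) \<mu> \<nu>"
  proof (rule energy_gap_tendsto[OF \<mu>\<nu>])
    fix t :: real assume t: "t \<in> {-1..1}"
    then show "(\<lambda>N. poly (p N) t ^ k) \<longlonglongrightarrow> s t ^ k"
      using sums[of t] by (auto intro!: tendsto_power simp: sums_def poly_p)
    fix N
    have "\<bar>poly (p N) t\<bar> \<le> (\<Sum>j<N. \<bar>a j * t ^ j\<bar>)" unfolding poly_p by (rule sum_abs)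
    also have "\<dots> \<le> (\<Sum>j<N. a j)"
    proof (rule sum_mono)
      fix j
      have "\<bar>t\<bar> ^ j \<le> 1" using t by (intro power_le_one) auto
      then show "\<bar>a j * t ^ j\<bar> \<le> a j"
        using mult_left_mono[of "\<bar>t\<bar> ^ j" 1 "a j"] a[of j] by (simp add: abs_mult power_abs)
    qed
    \<comment> \<open>At \<open>t = 1\<close> the series sums its coefficients, so
      \<open>s 1\<close> bounds all truncations uniformly.\<close>
    also have "\<dots> \<le> s 1"
      using sums[of 1] a sum_le_suminf[of a "{..<N}"] by (auto simp: sums_iff)
    finally show "\<bar>poly (p N) t ^ k\<bar> \<le> s 1 ^ k"
      by (simp add: power_abs power_mono)
  qed (auto intro!: continuous_intros s)
  moreover have "\<forall>\<^sub>F N in sequentially. a 1 ^ k * energy_gap (\<lambda>t. t ^ k) \<mu> \<nu> \<le>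
      energy_gap (\<lambda>t. poly (p N) t ^ k) \<mu> \<nu>"
    using eventually_ge_at_top[of 2]
  proof eventually_elim
    fix N :: nat assume N: "2 \<le> N"
    \<comment> \<open>For \<open>2 \<le> N\<close> the truncation contains the linear term. That
      term takes the part of \<open>q\<close> in \<open>coeff_power_diff_nonneg\<close>, while the
      local \<open>q\<close> collects all others.\<close>
    define q where "q = (\<Sum>j\<in>{..<N} - {1}. monom (a j) j)"
    have pq: "p N = q + monom (a 1) 1"
      using N sum.remove[of "{..<N}" 1 "\<lambda>j. monom (a j) j"] by (simp add: p_def q_def add.commute)
    have "0 \<le> energy_gap (poly ((q + monom (a 1) 1) ^ k - monom (a 1) 1 ^ k)) \<mu> \<nu>"
      using a by (intro energy_gap_poly_nonneg[OF \<mu>\<nu>] coeff_power_diff_nonneg)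
        (auto simp: q_def coeff_sum coeff_monom intro!: sum_nonneg)
    also have "poly ((q + monom (a 1) 1) ^ k - monom (a 1) 1 ^ k) =
        (\<lambda>t. poly (p N) t ^ k - a 1 ^ k * t ^ k)"
      by (auto simp: pq poly_monom power_mult_distrib)
    also have "energy_gap \<dots> \<mu> \<nu> =
        energy_gap (\<lambda>t. poly (p N) t ^ k) \<mu> \<nu> - a 1 ^ k * energy_gap (\<lambda>t. t ^ k) \<mu> \<nu>"
      by (subst energy_gap_diff[OF \<mu>\<nu>]) (auto intro!: continuous_intros simp: energy_gap_cmult[OF \<mu>\<nu>])
    finally show "a 1 ^ k * energy_gap (\<lambda>t. t ^ k) \<mu> \<nu> \<le> energy_gap (\<lambda>t. poly (p N) t ^ k) \<mu> \<nu>"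
      by simp
  qed
  ultimately show ?thesis by (rule tendsto_lowerbound) simp
qed

lemma arccos_eq_arcsin: "\<bar>t\<bar> \<le> 1 \<Longrightarrow> arccos t = pi / 2 - arcsin t"
  using arcsin_arccos_eq[of t] by (auto simp: abs_le_iff)

text \<open>The kernel is \<open>(1/2) powr \<delta> * (1 - H)\<close>, where \<open>H\<close> is a
  series in powers of \<open>s\<close> whose gaps are all nonnegative. If the gap of
  \<open>H\<close> vanishes, so does that of every \<open>s ^ k\<close> with
  \<open>k \<ge> 1\<close>; as \<open>s ^ k\<close> contains \<open>t ^ k\<close> with a positive
  coefficient, even moments are captured too, although \<open>arcsin\<close> is odd.\<close>

lemma energy_gap_dist_kernel:
  fixes \<mu> \<nu> :: "'a::euclidean_space measure"
  assumes \<mu>\<nu>: "\<mu> \<in> sphere_prob_measures" "\<nu> \<in> sphere_prob_measures"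
    and \<delta>: "0 < \<delta>" "\<delta> < 1"
  shows "energy_gap (dist_kernel \<delta>) \<mu> \<nu> \<le> 0"
    and "energy_gap (dist_kernel \<delta>) \<mu> \<nu> = 0 \<Longrightarrow> \<mu> = \<nu>"
proof -
  obtain a where a: "\<And>j. 0 \<le> a j" "\<And>j. odd j \<Longrightarrow> 0 < a j"
    and a_sums: "\<And>t. \<bar>t\<bar> \<le> 1 \<Longrightarrow> (\<lambda>j. a j * t ^ j) sums arcsin t"
    using arcsin_power_series by metis
  obtain b where b: "\<And>k. 0 \<le> b k" "\<And>k. 1 \<le> k \<Longrightarrow> 0 < b k" "summable b"
    and b_sums: "\<And>s. \<bar>s\<bar> \<le> 1 \<Longrightarrow> (\<lambda>k. b k * s ^ k) sums (1 - (1 - s) powr \<delta>)"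
    using one_minus_powr_power_series[OF \<delta>] by metis
  define s where "s = (\<lambda>t. 2 / pi * arcsin t)"
  have s_cont: "continuous_on {-1..1} s"
    unfolding s_def by (intro continuous_intros) auto
  have s_le: "\<bar>s t\<bar> \<le> 1" if "t \<in> {-1..1}" for t
    using arcsin_bounded[of t] that by (auto simp: s_def abs_le_iff field_simps)
  have s_sums: "(\<lambda>j. 2 / pi * a j * t ^ j) sums s t" if "\<bar>t\<bar> \<le> 1" for t
    using sums_mult[OF a_sums[OF that], of "2 / pi"] by (simp add: s_def mult.assoc)
  have s_gap: "(2 / pi * a 1) ^ k * energy_gap (\<lambda>t. t ^ k) \<mu> \<nu> \<le> energy_gap (\<lambda>t. s t ^ k) \<mu> \<nu>" for k
    using a by (intro energy_gap_power_of_series_ge[OF \<mu>\<nu> _ s_cont s_sums]) auto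
  have s_gap_nonneg: "0 \<le> energy_gap (\<lambda>t. s t ^ k) \<mu> \<nu>" for k
    by (rule order_trans[OF _ s_gap]) (use a energy_gap_power_nonneg[OF \<mu>\<nu>] in auto)
  define H where "H = (\<lambda>t. 1 - (1 - s t) powr \<delta>)"
  have H_cont: "continuous_on {-1..1} H"
    unfolding H_def using \<delta> s_le
    by (intro continuous_intros continuous_on_powr' s_cont) (auto simp: abs_le_iff)
  have gap_H: "(\<lambda>k. b k * energy_gap (\<lambda>t. s t ^ k) \<mu> \<nu>) sums energy_gap H \<mu> \<nu>"
  proof (rule energy_gap_sums[OF \<mu>\<nu> _ H_cont b(1,3)])
    show "\<bar>s t ^ k\<bar> \<le> 1" if "t \<in> {-1..1}" for t k
      using s_le[OF that] by (simp add: power_abs power_le_one)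
  qed (use b_sums s_le in \<open>auto simp: H_def intro!: continuous_intros s_cont\<close>)
  have "energy_gap (dist_kernel \<delta>) \<mu> \<nu> = energy_gap (\<lambda>t. (1/2) powr \<delta> * (1 - H t)) \<mu> \<nu>"
  proof (rule energy_gap_cong[OF \<mu>\<nu>])
    fix t :: real assume t: "t \<in> {-1..1}"
    have "arccos t / pi = 1/2 * (1 - s t)"
      using t arccos_eq_arcsin[of t] by (auto simp: s_def field_simps)
    then show "dist_kernel \<delta> t = (1/2) powr \<delta> * (1 - H t)"
      using s_le[OF t] by (simp only: dist_kernel_def H_def) (subst powr_mult; simp)
  qed
  also have "\<dots> = - ((1/2) powr \<delta> * energy_gap H \<mu> \<nu>)"
    by (simp add: energy_gap_cmult[OF \<mu>\<nu>] energy_gap_diff[OF \<mu>\<nu>] energy_gap_const[OF \<mu>\<nu>] H_cont)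
  finally have eq: "energy_gap (dist_kernel \<delta>) \<mu> \<nu> = - ((1/2) powr \<delta> * energy_gap H \<mu> \<nu>)" .
  have terms: "0 \<le> b k * energy_gap (\<lambda>t. s t ^ k) \<mu> \<nu>" for k
    using b(1) s_gap_nonneg by simp
  have "0 \<le> energy_gap H \<mu> \<nu>"
    using suminf_nonneg[OF sums_summable[OF gap_H] terms] gap_H by (simp add: sums_iff)
  then show "energy_gap (dist_kernel \<delta>) \<mu> \<nu> \<le> 0" by (simp add: eq)
  assume "energy_gap (dist_kernel \<delta>) \<mu> \<nu> = 0"
  then have "energy_gap H \<mu> \<nu> = 0" by (simp add: eq)
  then have "b k * energy_gap (\<lambda>t. s t ^ k) \<mu> \<nu> = 0" for k
    using gap_H suminf_eq_zero_iff[OF sums_summable[OF gap_H] terms] by (simp add: sums_iff)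
  then have s0: "energy_gap (\<lambda>t. s t ^ k) \<mu> \<nu> = 0" if "1 \<le> k" for k
    using b(2)[OF that] by (metis less_irrefl mult_eq_0_iff)
  have "energy_gap (\<lambda>t. t ^ k) \<mu> \<nu> = 0" for k
  proof (cases "k = 0")
    case False
    have "(2 / pi * a 1) ^ k * energy_gap (\<lambda>t. t ^ k) \<mu> \<nu> \<le> 0"
      using s_gap[of k] s0[of k] False by simp
    moreover have "0 < (2 / pi * a 1) ^ k" using a(2)[of 1] by simp
    ultimately show ?thesis
      using energy_gap_power_nonneg[OF \<mu>\<nu>, of k] by (auto simp: mult_le_0_iff)
  qed (simp add: energy_gap_const[OF \<mu>\<nu>])
  then show "\<mu> = \<nu>"
    by (intro measure_eq_if_moments_eq[OF \<mu>\<nu>] energy_gap_power_eq_0_imp[OF \<mu>\<nu> _ _ refl])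
qed

text \<open>The potential of \<open>sphere_sigma\<close> is constant, so its integral against every
  probability measure is the same: both mixed terms equal the energy of
  \<open>sphere_sigma\<close>.\<close>

lemma energy_gap_sphere_sigma:
  fixes \<mu> :: "(real ^ 'n) measure"
  assumes \<mu>: "\<mu> \<in> sphere_prob_measures" and f: "continuous_on {-1..1} f"
  shows "energy_gap f \<mu> sphere_sigma =
    cross_energy f \<mu> \<mu> - cross_energy f (sphere_sigma :: (real ^ 'n) measure) sphere_sigma"
proof -
  note \<sigma> = sphere_sigma_in_sphere_prob_measures[where 'a="real ^ 'n"]
  obtain y0 :: "real ^ 'n" where y0: "y0 \<in> sphere 0 1"
    using vector_choose_size[of 1] by auto
  have const: "cross_energy f sphere_sigma \<nu> = (LINT x|sphere_sigma. f (x \<bullet> y0))"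
    if \<nu>: "\<nu> \<in> sphere_prob_measures" for \<nu> :: "(real ^ 'n) measure"
  proof -
    interpret prob_space \<nu> by (rule prob_space_sphere[OF \<nu>])
    have "cross_energy f sphere_sigma \<nu> = (LINT y|\<nu>. LINT x|sphere_sigma. f (x \<bullet> y0))"
      unfolding cross_energy_iterated(1)[OF \<sigma> \<nu> f]
      by (intro Bochner_Integration.integral_cong sphere_sigma_potential_const[OF _ y0 f])
         (auto simp: space_sphere[OF \<nu>])
    then show ?thesis by (simp add: prob_space)
  qed
  show ?thesis
    using const[OF \<mu>] const[OF \<sigma>] cross_energy_commute[OF \<mu> \<sigma> f] by (simp add: energy_gap_def)
qed

section \<open>Exponent one\<close>

text \<open>The comparison measure for exponent one: its gap to \<open>\<mu>\<close> under the
  kernel \<open>arcsin\<close> detects the lack of central symmetry.\<close>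

definition reflect :: "'a::euclidean_space measure \<Rightarrow> 'a measure" where
  "reflect \<mu> = distr \<mu> sphere_borel uminus"

lemma measurable_uminus_sphere:
  assumes "\<mu> \<in> sphere_prob_measures"
  shows "uminus \<in> \<mu> \<rightarrow>\<^sub>M sphere_borel"
proof -
  have "orthogonal_transformation (uminus :: 'a \<Rightarrow> 'a)"
    by (auto simp: orthogonal_transformation_def linear_iff)
  then show ?thesis
    using sphere_sigma_distr_orthogonal_transformation(1) measurable_cong_sets[OF sets_sphere[OF assms] refl]
    by blast
qed

lemma reflect_in_sphere_prob_measures:
  assumes "\<mu> \<in> sphere_prob_measures"
  shows "reflect \<mu> \<in> sphere_prob_measures"
  using prob_space.prob_space_distr[OF prob_space_sphere[OF assms] measurable_uminus_sphere[OF assms]]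
  by (simp add: sphere_prob_measures_def reflect_def)

lemma centrally_symmetric_iff_reflect:
  fixes \<mu> :: "'a::euclidean_space measure"
  assumes \<mu>: "\<mu> \<in> sphere_prob_measures"
  shows "centrally_symmetric \<mu> \<longleftrightarrow> reflect \<mu> = \<mu>"
proof -
  have eq: "emeasure (reflect \<mu>) E = emeasure \<mu> (uminus ` E)" if E: "E \<in> sets \<mu>" for E
  proof -
    have "E \<subseteq> sphere 0 1"
      using sets.sets_into_space[OF E] by (simp add: space_sphere[OF \<mu>])
    then have "uminus -` E \<inter> space \<mu> = uminus ` E"
      by (auto simp: space_sphere[OF \<mu>] image_iff) (metis minus_minus)
    then show ?thesis
      using E by (simp add: reflect_def emeasure_distr[OF measurable_uminus_sphere[OF \<mu>]] sets_sphere[OF \<mu>])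
  qed
  show ?thesis
  proof
    assume "centrally_symmetric \<mu>"
    then show "reflect \<mu> = \<mu>"
      by (intro measure_eqI)
         (auto simp: eq centrally_symmetric_def sets_sphere[OF \<mu>]
            sets_sphere[OF reflect_in_sphere_prob_measures[OF \<mu>]])
  next
    assume "reflect \<mu> = \<mu>"
    then show "centrally_symmetric \<mu>"
      using eq by (auto simp: centrally_symmetric_def)
  qed
qed

lemma integral_reflect:
  fixes f :: "'a::euclidean_space \<Rightarrow> real"
  assumes \<mu>: "\<mu> \<in> sphere_prob_measures" and f: "continuous_on (sphere 0 1) f"
  shows "(LINT x|reflect \<mu>. f x) = (LINT x|\<mu>. f (- x))"
proof -
  have "f \<in> borel_measurable sphere_borel"
    unfolding sphere_borel_def by (rule borel_measurable_continuous_on_restrict[OF f])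
  then show ?thesis
    unfolding reflect_def by (rule integral_distr[OF measurable_uminus_sphere[OF \<mu>]])
qed

lemma cross_energy_reflect:
  fixes \<mu> \<nu> :: "'a::euclidean_space measure"
  assumes \<mu>: "\<mu> \<in> sphere_prob_measures" and \<nu>: "\<nu> \<in> sphere_prob_measures"
    and f: "continuous_on {-1..1} f"
  shows "cross_energy f \<mu> (reflect \<nu>) = cross_energy (\<lambda>t. f (- t)) \<mu> \<nu>"
proof -
  have f': "continuous_on {-1..1} (\<lambda>t. f (- t))"
    by (rule continuous_on_compose2[OF f]) (auto intro: continuous_intros)
  show ?thesis
    unfolding cross_energy_iterated(2)[OF \<mu> reflect_in_sphere_prob_measures[OF \<nu>] f]
      cross_energy_iterated(2)[OF \<mu> \<nu> f']
  proof (rule Bochner_Integration.integral_cong[OF refl])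
    fix x assume "x \<in> space \<mu>"
    then have "x \<in> sphere 0 1" by (simp add: space_sphere[OF \<mu>])
    then have "continuous_on (sphere 0 1) (\<lambda>y. f (x \<bullet> y))"
      using inner_sphere_bounds[of x]
      by (intro continuous_on_compose2[OF f]) (auto intro!: continuous_intros simp del: mem_sphere)
    from integral_reflect[OF \<nu> this]
    show "(LINT y|reflect \<nu>. f (x \<bullet> y)) = (LINT y|\<nu>. f (- (x \<bullet> y)))" by simp
  qed
qed

text \<open>For an odd kernel, reflecting one measure flips the sign of the cross energy and
  reflecting both restores it, so the four terms of the gap contribute equally.\<close>

lemma energy_gap_reflect:
  fixes \<mu> :: "'a::euclidean_space measure"
  assumes \<mu>: "\<mu> \<in> sphere_prob_measures" and f: "continuous_on {-1..1} f"
    and odd: "\<And>t. t \<in> {-1..1} \<Longrightarrow> f (- t) = - f t"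
  shows "energy_gap f \<mu> (reflect \<mu>) = 4 * cross_energy f \<mu> \<mu>"
proof -
  note R = reflect_in_sphere_prob_measures[OF \<mu>]
  have f': "continuous_on {-1..1} (\<lambda>t. f (- t))"
    by (rule continuous_on_compose2[OF f]) (auto intro: continuous_intros)
  have "cross_energy (\<lambda>t. f (- t)) \<mu> \<mu> = cross_energy (\<lambda>t. - f t) \<mu> \<mu>"
    by (rule cross_energy_cong[OF \<mu> \<mu>]) (rule odd)
  then have 1: "cross_energy (\<lambda>t. f (- t)) \<mu> \<mu> = - cross_energy f \<mu> \<mu>"
    by (simp add: cross_energy_def)
  have "cross_energy f (reflect \<mu>) (reflect \<mu>) = cross_energy f \<mu> \<mu>"
    unfolding cross_energy_reflect[OF R \<mu> f] cross_energy_commute[OF R \<mu> f']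
      cross_energy_reflect[OF \<mu> \<mu> f'] by simp
  then show ?thesis
    unfolding energy_gap_def cross_energy_commute[OF R \<mu> f] cross_energy_reflect[OF \<mu> \<mu> f] 1 by simp
qed

text \<open>The constant part \<open>pi / 2\<close> of \<open>arccos\<close> contributes 1/2; the
  remaining kernel is odd, which produces the factor 4.\<close>

lemma geo_energy_1_eq:
  fixes \<mu> :: "'a::euclidean_space measure"
  assumes \<mu>: "\<mu> \<in> sphere_prob_measures"
  shows "geo_energy 1 \<mu> = 1/2 - energy_gap arcsin \<mu> (reflect \<mu>) / (4 * pi)"
proof -
  interpret prob_space "\<mu> \<Otimes>\<^sub>M \<mu>" by (rule prob_space_sphere_pair[OF \<mu> \<mu>])
  have "geo_energy 1 \<mu> = cross_energy (\<lambda>t. 1/2 - arcsin t / pi) \<mu> \<mu>"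
    unfolding geo_energy_eq_cross_energy[OF \<mu> zero_less_one]
  proof (rule cross_energy_cong[OF \<mu> \<mu>])
    fix t :: real assume t: "t \<in> {-1..1}"
    then have "0 \<le> arccos t" by (simp add: arccos_lbound)
    then show "dist_kernel 1 t = 1/2 - arcsin t / pi"
      using t arccos_eq_arcsin[of t] by (auto simp: dist_kernel_def field_simps)
  qed
  also have "\<dots> = 1/2 - cross_energy arcsin \<mu> \<mu> / pi"
    using integrable_kernel[OF \<mu> \<mu> continuous_on_arcsin'] by (simp add: cross_energy_def prob_space)
  also have "energy_gap arcsin \<mu> (reflect \<mu>) = 4 * cross_energy arcsin \<mu> \<mu>"
    by (rule energy_gap_reflect[OF \<mu> continuous_on_arcsin']) (simp add: arcsin_minus)
  ultimately show ?thesis by simp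
qed

text \<open>A vanishing gap forces the odd moments to agree, since the odd coefficients of
  \<open>arcsin\<close> are positive; moments of even degree are unchanged by reflection.\<close>

lemma energy_gap_arcsin_reflect:
  fixes \<mu> :: "'a::euclidean_space measure"
  assumes \<mu>: "\<mu> \<in> sphere_prob_measures"
  shows "0 \<le> energy_gap arcsin \<mu> (reflect \<mu>)"
    and "energy_gap arcsin \<mu> (reflect \<mu>) = 0 \<longleftrightarrow> reflect \<mu> = \<mu>"
proof -
  note R = reflect_in_sphere_prob_measures[OF \<mu>]
  obtain a where a: "\<And>j. 0 \<le> a j" "\<And>j. odd j \<Longrightarrow> 0 < a j" "summable a"
    and a_sums: "\<And>t. \<bar>t\<bar> \<le> 1 \<Longrightarrow> (\<lambda>j. a j * t ^ j) sums arcsin t"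
    using arcsin_power_series by metis
  have gap: "(\<lambda>j. a j * energy_gap (\<lambda>t. t ^ j) \<mu> (reflect \<mu>)) sums energy_gap arcsin \<mu> (reflect \<mu>)"
  proof (rule energy_gap_sums[OF \<mu> R _ continuous_on_arcsin' a(1,3)])
    fix t :: real and k assume "t \<in> {-1..1}"
    then have t: "\<bar>t\<bar> \<le> 1" by auto
    then show "\<bar>t ^ k\<bar> \<le> 1" by (simp add: power_abs power_le_one)
    show "(\<lambda>j. a j * t ^ j) sums arcsin t" by (rule a_sums[OF t])
  qed (intro continuous_intros)
  have terms: "0 \<le> a j * energy_gap (\<lambda>t. t ^ j) \<mu> (reflect \<mu>)" for j
    using a(1) energy_gap_power_nonneg[OF \<mu> R] by simp
  show "0 \<le> energy_gap arcsin \<mu> (reflect \<mu>)"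
    using suminf_nonneg[OF sums_summable[OF gap] terms] gap by (simp add: sums_iff)
  show "energy_gap arcsin \<mu> (reflect \<mu>) = 0 \<longleftrightarrow> reflect \<mu> = \<mu>"
  proof
    assume "energy_gap arcsin \<mu> (reflect \<mu>) = 0"
    then have "a j * energy_gap (\<lambda>t. t ^ j) \<mu> (reflect \<mu>) = 0" for j
      using gap suminf_eq_zero_iff[OF sums_summable[OF gap] terms] by (simp add: sums_iff)
    then have odd0: "energy_gap (\<lambda>t. t ^ j) \<mu> (reflect \<mu>) = 0" if "odd j" for j
      using a(2)[OF that] by (metis less_irrefl mult_eq_0_iff)
    have "(LINT x|\<mu>. monomial bs x) = (LINT x|reflect \<mu>. monomial bs x)" if bs: "set bs \<subseteq> Basis" for bs
    proof (cases "odd (length bs)")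
      case True
      then show ?thesis by (intro energy_gap_power_eq_0_imp[OF \<mu> R odd0 bs refl])
    next
      case False
      then show ?thesis
        by (simp add: integral_reflect[OF \<mu> continuous_on_monomial] monomial_minus)
    qed
    then show "reflect \<mu> = \<mu>" by (intro measure_eq_if_moments_eq[OF \<mu> R, symmetric])
  next
    assume "reflect \<mu> = \<mu>"
    then show "energy_gap arcsin \<mu> (reflect \<mu>) = 0" by (simp add: energy_gap_def)
  qed
qed

lemma geo_energy_1_bound:
  fixes \<mu> :: "'a::euclidean_space measure"
  assumes \<mu>: "\<mu> \<in> sphere_prob_measures"
  shows "geo_energy 1 \<mu> \<le> 1/2" and "geo_energy 1 \<mu> = 1/2 \<longleftrightarrow> centrally_symmetric \<mu>"
  using energy_gap_arcsin_reflect[OF \<mu>]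
  by (simp_all add: geo_energy_1_eq[OF \<mu>] centrally_symmetric_iff_reflect[OF \<mu>])

section \<open>Exponents above one\<close>

text \<open>For \<open>0 < u < 1\<close> the power \<open>u powr \<delta>\<close> lies strictly
  below \<open>u\<close>, while \<open>u = 0\<close> and \<open>u = 1\<close> correspond to
  \<open>t = 1\<close> and \<open>t = -1\<close>. Equality at coincident points rests on
  \<open>0 powr \<delta> = 0\<close>.\<close>

lemma dist_kernel_le:
  assumes "1 < \<delta>" "t \<in> {-1..1}"
  shows "dist_kernel \<delta> t \<le> dist_kernel 1 t"
    and "dist_kernel \<delta> t = dist_kernel 1 t \<longleftrightarrow> t = 1 \<or> t = -1"
proof -
  define u where "u = arccos t / pi"
  have u: "0 \<le> u" "u \<le> 1"
    using assms(2) arccos_lbound[of t] arccos_ubound[of t] by (auto simp: u_def)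
  have "t = cos (pi * u)" using assms(2) by (simp add: u_def)
  then have "t = 1 \<longleftrightarrow> u = 0" "t = -1 \<longleftrightarrow> u = 1" by (auto simp: u_def)
  moreover have "u powr \<delta> \<le> u \<and> (u powr \<delta> = u \<longleftrightarrow> u = 0 \<or> u = 1)"
  proof (cases "u = 0 \<or> u = 1")
    case True
    then show ?thesis by auto
  next
    case False
    then show ?thesis using powr_less_mono'[of u 1 \<delta>] u assms(1) by simp
  qed
  ultimately show "dist_kernel \<delta> t \<le> dist_kernel 1 t"
    and "dist_kernel \<delta> t = dist_kernel 1 t \<longleftrightarrow> t = 1 \<or> t = -1"
    using u by (simp_all add: dist_kernel_def flip: u_def)
qed

text \<open>The iterated almost-everywhere form of the equality case is what allows a single point
  \<open>x\<close> to be selected later.\<close>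

lemma cross_energy_nonneg_eq_0_iff:
  fixes \<mu> \<nu> :: "'a::euclidean_space measure"
  assumes \<mu>: "\<mu> \<in> sphere_prob_measures" and \<nu>: "\<nu> \<in> sphere_prob_measures"
    and f: "continuous_on {-1..1} f" and nonneg: "\<And>t. t \<in> {-1..1} \<Longrightarrow> 0 \<le> f t"
  shows "0 \<le> cross_energy f \<mu> \<nu>"
    and "cross_energy f \<mu> \<nu> = 0 \<longleftrightarrow> (AE x in \<mu>. AE y in \<nu>. f (x \<bullet> y) = 0)"
proof -
  interpret M: prob_space \<mu> by (rule prob_space_sphere[OF \<mu>])
  interpret N: prob_space \<nu> by (rule prob_space_sphere[OF \<nu>])
  interpret pair_prob_space \<mu> \<nu> ..
  have ae: "AE z in \<mu> \<Otimes>\<^sub>M \<nu>. 0 \<le> f (fst z \<bullet> snd z)"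
    using measurable_space[OF inner_measurable_sphere_pair[OF \<mu> \<nu>]]
    by (intro AE_I2 nonneg) (auto simp: space_restrict_space)
  show "0 \<le> cross_energy f \<mu> \<nu>"
    unfolding cross_energy_def by (rule integral_nonneg_AE[OF ae])
  have "cross_energy f \<mu> \<nu> = 0 \<longleftrightarrow> (AE z in \<mu> \<Otimes>\<^sub>M \<nu>. f (fst z \<bullet> snd z) = 0)"
    unfolding cross_energy_def
    by (rule integral_nonneg_eq_0_iff_AE[OF integrable_kernel[OF \<mu> \<nu> f] ae])
  also have "\<dots> \<longleftrightarrow> (AE x in \<mu>. AE y in \<nu>. f (x \<bullet> y) = 0)"
    using measurable_sets[OF measurable_kernel[OF \<mu> \<nu> f], of "{0}"]
    by (subst AE_pair_iff) (simp_all add: vimage_def Int_def conj_commute)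
  finally show "cross_energy f \<mu> \<nu> = 0 \<longleftrightarrow> (AE x in \<mu>. AE y in \<nu>. f (x \<bullet> y) = 0)" .
qed

lemma inner_sphere_eq_1_iff:
  fixes x y :: "'a::euclidean_space"
  assumes "x \<in> sphere 0 1" "y \<in> sphere 0 1"
  shows "x \<bullet> y = 1 \<longleftrightarrow> y = x" and "x \<bullet> y = -1 \<longleftrightarrow> y = - x"
proof -
  have *: "u \<bullet> v = 1 \<longleftrightarrow> v = u" if "u \<in> sphere 0 1" "v \<in> sphere 0 1" for u v :: 'a
  proof
    assume "u \<bullet> v = 1"
    then have "(v - u) \<bullet> (v - u) = 0"
      using that by (simp add: inner_diff_left inner_diff_right inner_commute norm_eq_1)
    then show "v = u" by simp
  qed (use that in \<open>simp add: norm_eq_1\<close>)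
  show "x \<bullet> y = 1 \<longleftrightarrow> y = x" by (rule *[OF assms])
  show "x \<bullet> y = -1 \<longleftrightarrow> y = - x"
    using *[of "- x" y] assms by (auto simp: minus_equation_iff)
qed

text \<open>The difference of the two kernels is nonnegative and vanishes only at the inner products
  1 and -1, that is, for equal or antipodal points.\<close>

lemma geo_energy_le_geo_energy_1:
  fixes \<mu> :: "'a::euclidean_space measure"
  assumes \<mu>: "\<mu> \<in> sphere_prob_measures" and \<delta>: "1 < \<delta>"
  shows "geo_energy \<delta> \<mu> \<le> geo_energy 1 \<mu>"
    and "geo_energy \<delta> \<mu> = geo_energy 1 \<mu> \<longleftrightarrow> (AE x in \<mu>. AE y in \<mu>. y = x \<or> y = - x)"
proof -
  let ?g = "\<lambda>t. dist_kernel 1 t - dist_kernel \<delta> t"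
  have \<delta>0: "0 < \<delta>" using \<delta> by simp
  have cont: "continuous_on {-1..1} ?g"
    by (intro continuous_on_diff continuous_on_dist_kernel \<delta>0) simp
  have diff: "cross_energy ?g \<mu> \<mu> = geo_energy 1 \<mu> - geo_energy \<delta> \<mu>"
    using integrable_kernel[OF \<mu> \<mu> continuous_on_dist_kernel] \<delta>0
    by (simp add: geo_energy_eq_cross_energy[OF \<mu>] cross_energy_def)
  note nonneg = cross_energy_nonneg_eq_0_iff[OF \<mu> \<mu> cont]
  show "geo_energy \<delta> \<mu> \<le> geo_energy 1 \<mu>"
    using nonneg(1) dist_kernel_le(1)[OF \<delta>] diff by simp
  have "geo_energy \<delta> \<mu> = geo_energy 1 \<mu> \<longleftrightarrow> (AE x in \<mu>. AE y in \<mu>. ?g (x \<bullet> y) = 0)"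
    using nonneg(2) dist_kernel_le(1)[OF \<delta>] diff by auto
  also have "\<dots> \<longleftrightarrow> (AE x in \<mu>. AE y in \<mu>. y = x \<or> y = - x)"
  proof (intro AE_cong)
    fix x y assume "x \<in> space \<mu>" "y \<in> space \<mu>"
    then have xy: "x \<in> sphere 0 1" "y \<in> sphere 0 1" by (simp_all add: space_sphere[OF \<mu>])
    show "?g (x \<bullet> y) = 0 \<longleftrightarrow> y = x \<or> y = - x"
      using dist_kernel_le(2)[OF \<delta> inner_sphere_bounds[OF xy]] inner_sphere_eq_1_iff[OF xy] by auto
  qed
  finally show "geo_energy \<delta> \<mu> = geo_energy 1 \<mu> \<longleftrightarrow> (AE x in \<mu>. AE y in \<mu>. y = x \<or> y = - x)" .
qed

section \<open>Measures carried by an antipodal pair\<close>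

lemma singleton_sets_sphere_borel: "p \<in> sphere 0 1 \<Longrightarrow> {p} \<in> sets sphere_borel"
  unfolding sphere_borel_def by (subst sets_restrict_space_iff) auto

text \<open>By \<open>measure_antipodal_unique\<close> these properties determine the measure, so it
  can later be recognised without computing its values.\<close>

lemma antipodal_dirac_properties:
  fixes p :: "'a::euclidean_space"
  assumes p: "p \<in> sphere 0 1"
  shows "antipodal_dirac p \<in> sphere_prob_measures" (is ?P)
    and "centrally_symmetric (antipodal_dirac p)" (is ?S)
    and "AE x in antipodal_dirac p. x = p \<or> x = - p" (is ?A)
proof -
  have em: "emeasure (antipodal_dirac p) E = (indicator E p + indicator E (- p)) / 2"
    if "E \<in> sets sphere_borel" for E
    using that by (simp add: emeasure_antipodal_dirac)
  have sp: "space (antipodal_dirac p) = sphere 0 1"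
    using sets_eq_imp_space_eq[OF sets_antipodal_dirac[of p]] by simp
  have S: "sphere (0::'a) 1 \<in> sets sphere_borel"
    using sets.top[of "sphere_borel :: 'a measure"] by simp
  have "emeasure (antipodal_dirac p) (sphere 0 1) = 1"
    using p by (simp add: em[OF S])
  then show ?P
    by (auto simp: sphere_prob_measures_def sp intro!: prob_spaceI)
  show ?S
    unfolding centrally_symmetric_def
  proof
    fix E assume "E \<in> sets (antipodal_dirac p)"
    then have E: "E \<in> sets sphere_borel" by simp
    have "E \<subseteq> sphere 0 1" using sets.sets_into_space[OF E] by simp
    then have "uminus ` E = uminus -` E \<inter> space sphere_borel"
      by (auto simp: image_iff) (metis minus_minus)
    moreover have "uminus \<in> sphere_borel \<rightarrow>\<^sub>M (sphere_borel :: 'a measure)"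
      using measurable_uminus_sphere[OF \<open>?P\<close>] measurable_cong_sets[OF sets_antipodal_dirac refl] by blast
    ultimately have E': "uminus ` E \<in> sets sphere_borel"
      using E measurable_sets[of uminus sphere_borel sphere_borel E] by simp
    have "p \<in> uminus ` E \<longleftrightarrow> - p \<in> E" "- p \<in> uminus ` E \<longleftrightarrow> p \<in> E"
      by (auto simp: image_iff) (metis minus_minus)
    then show "emeasure (antipodal_dirac p) E = emeasure (antipodal_dirac p) (uminus ` E)"
      by (simp add: em[OF E] em[OF E'] indicator_def add.commute)
  qed
  show ?A
  proof (rule AE_I)
    let ?N = "sphere 0 1 - {p} - {- p}"
    have "?N \<in> sets sphere_borel"
      using S singleton_sets_sphere_borel[of p] singleton_sets_sphere_borel[of "- p"] p by auto
    then show "emeasure (antipodal_dirac p) ?N = 0" "?N \<in> sets (antipodal_dirac p)"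
      by (simp_all add: em)
    show "{x \<in> space (antipodal_dirac p). \<not> (x = p \<or> x = - p)} \<subseteq> ?N" by (auto simp: sp)
  qed
qed

text \<open>Symmetry gives \<open>p\<close> and \<open>- p\<close> equal mass and the support
  condition makes their total one, so each carries one half; they are distinct because
  \<open>p\<close> has norm one.\<close>

lemma measure_antipodal_unique:
  fixes \<mu> \<nu> :: "'a::euclidean_space measure"
  assumes p: "p \<in> sphere 0 1"
    and \<mu>: "\<mu> \<in> sphere_prob_measures" "centrally_symmetric \<mu>" "AE x in \<mu>. x = p \<or> x = - p"
    and \<nu>: "\<nu> \<in> sphere_prob_measures" "centrally_symmetric \<nu>" "AE x in \<nu>. x = p \<or> x = - p"
  shows "\<mu> = \<nu>"
proof -
  have meas: "emeasure \<alpha> E = ennreal ((indicator E p + indicator E (- p)) / 2)"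
    if \<alpha>: "\<alpha> \<in> sphere_prob_measures" "centrally_symmetric \<alpha>" "AE x in \<alpha>. x = p \<or> x = - p"
      and E: "E \<in> sets sphere_borel" for \<alpha> E
  proof -
    interpret prob_space \<alpha> by (rule prob_space_sphere[OF \<alpha>(1)])
    have "p \<noteq> - p"
    proof
      assume "p = - p"
      then have "2 *\<^sub>R p = 0" by (simp only: eq_neg_iff_add_eq_0 scaleR_2)
      then have "p = 0" by simp
      with p show False by simp
    qed
    have [simp]: "{p} \<in> sets \<alpha>" "{- p} \<in> sets \<alpha>"
      using singleton_sets_sphere_borel[of p] singleton_sets_sphere_borel[of "- p"] p
      by (auto simp: sets_sphere[OF \<alpha>(1)])
    have "measure \<alpha> {- p} = measure \<alpha> {p}"
    proof -
      have "emeasure \<alpha> {p} = emeasure \<alpha> (uminus ` {p})"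
        by (rule \<alpha>(2)[unfolded centrally_symmetric_def, rule_format]) simp
      then show ?thesis by (simp add: measure_def)
    qed
    moreover have "measure \<alpha> {p, - p} = measure \<alpha> {p} + measure \<alpha> {- p}"
      using finite_measure_Union[of "{p}" "{- p}"] \<open>p \<noteq> - p\<close> by (simp add: insert_commute)
    moreover have "measure \<alpha> {p, - p} = 1"
    proof -
      have "{p, - p} \<in> sets \<alpha>" using sets.Un[of "{p}" \<alpha> "{- p}"] by (simp add: insert_commute)
      then show ?thesis using \<alpha>(3) by (subst prob_eq_1) auto
    qed
    ultimately have half: "measure \<alpha> {p} = 1/2" "measure \<alpha> {- p} = 1/2" by auto
    let ?F = "({p} \<inter> E) \<union> ({- p} \<inter> E)"
    have E\<alpha>: "E \<in> sets \<alpha>" using E by (simp add: sets_sphere[OF \<alpha>(1)])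
    have [simp]: "{p} \<inter> E \<in> sets \<alpha>" "{- p} \<inter> E \<in> sets \<alpha>"
      using E\<alpha> by (simp_all only: sets.Int \<open>{p} \<in> sets \<alpha>\<close> \<open>{- p} \<in> sets \<alpha>\<close>)
    have "measure \<alpha> E = measure \<alpha> ?F"
      using \<alpha>(3) E\<alpha> by (intro measure_eq_AE sets.Un) auto
    also have "\<dots> = measure \<alpha> ({p} \<inter> E) + measure \<alpha> ({- p} \<inter> E)"
      using E\<alpha> \<open>p \<noteq> - p\<close> by (intro finite_measure_Union) auto
    also have "\<dots> = (indicator E p + indicator E (- p)) / 2"
      by (auto simp: half indicator_def)
    finally show ?thesis by (simp add: emeasure_eq_measure)
  qed
  show ?thesis
    by (rule measure_eqI) (auto simp: sets_sphere[OF \<mu>(1)] sets_sphere[OF \<nu>(1)] meas \<mu> \<nu>)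
qed

text \<open>The support condition puts the measure into the equality case of the comparison with
  exponent one, where symmetry gives 1/2.\<close>

lemma geo_energy_antipodal_dirac:
  fixes p :: "'a::euclidean_space"
  assumes p: "p \<in> sphere 0 1" and \<delta>: "1 \<le> \<delta>"
  shows "geo_energy \<delta> (antipodal_dirac p) = 1/2"
proof -
  note A = antipodal_dirac_properties[OF p]
  have "AE x in antipodal_dirac p. AE y in antipodal_dirac p. y = x \<or> y = - x"
  proof (rule AE_mp[OF A(3) AE_I2], rule impI)
    fix x assume "x = p \<or> x = - p"
    then show "AE y in antipodal_dirac p. y = x \<or> y = - x"
      using A(3) by auto
  qed
  then have "geo_energy \<delta> (antipodal_dirac p) = geo_energy 1 (antipodal_dirac p)"
    using geo_energy_le_geo_energy_1(2)[OF A(1)] \<delta> by (cases "\<delta> = 1") auto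
  then show ?thesis using geo_energy_1_bound(2)[OF A(1)] A(2) by simp
qed

text \<open>Both inequalities in
  \<open>geo_energy \<delta> \<mu> \<le> geo_energy 1 \<mu> \<le> 1/2\<close> become equalities: the
  first confines the mass to an antipodal pair, the second makes it symmetric.\<close>

lemma geo_energy_eq_half_imp_antipodal:
  fixes \<mu> :: "'a::euclidean_space measure"
  assumes \<mu>: "\<mu> \<in> sphere_prob_measures" and \<delta>: "1 < \<delta>" and half: "1/2 \<le> geo_energy \<delta> \<mu>"
  shows "\<exists>p\<in>sphere 0 1. \<mu> = antipodal_dirac p"
proof -
  interpret prob_space \<mu> by (rule prob_space_sphere[OF \<mu>])
  have "geo_energy \<delta> \<mu> = geo_energy 1 \<mu>" "geo_energy 1 \<mu> = 1/2"
    using geo_energy_le_geo_energy_1(1)[OF \<mu> \<delta>] geo_energy_1_bound(1)[OF \<mu>] half by auto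
  then have ae: "AE x in \<mu>. AE y in \<mu>. y = x \<or> y = - x" and sym: "centrally_symmetric \<mu>"
    using geo_energy_le_geo_energy_1(2)[OF \<mu> \<delta>] geo_energy_1_bound(2)[OF \<mu>] by auto
  \<comment> \<open>Almost every \<open>x\<close> can serve as \<open>p\<close>; if no point of the
    sphere did, \<open>False\<close> would hold almost everywhere, which a probability measure rules
    out.\<close>
  have "\<exists>p\<in>sphere 0 1. AE y in \<mu>. y = p \<or> y = - p"
  proof (rule ccontr)
    assume *: "\<not> ?thesis"
    have "AE x in \<mu>. False"
      using ae AE_space by eventually_elim (use * in \<open>simp add: space_sphere[OF \<mu>]\<close>)
    then show False by (simp add: AE_False)
  qed
  then obtain p where p: "p \<in> sphere 0 1" "AE y in \<mu>. y = p \<or> y = - p" by blast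
  have "\<mu> = antipodal_dirac p"
    by (rule measure_antipodal_unique[OF p(1) \<mu> sym p(2) antipodal_dirac_properties[OF p(1)]])
  with p(1) show ?thesis by blast
qed

section \<open>Attained bounds and the three ranges of the exponent\<close>

lemma is_arg_max_iff_attains_bound:
  fixes f :: "'b \<Rightarrow> real"
  assumes bound: "\<And>x. x \<in> S \<Longrightarrow> f x \<le> c" and x\<^sub>0: "x\<^sub>0 \<in> S" "f x\<^sub>0 = c"
  shows "is_arg_max f (\<lambda>x. x \<in> S) x \<longleftrightarrow> x \<in> S \<and> f x = c"
proof
  assume "is_arg_max f (\<lambda>x. x \<in> S) x"
  \<comment> \<open>\<open>is_arg_max\<close> only excludes strictly larger values; tested on
    \<open>x\<^sub>0\<close> it yields \<open>c \<le> f x\<close>.\<close>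
  then have "x \<in> S" "c \<le> f x" using x\<^sub>0 by (auto simp: is_arg_max_def not_less)
  then show "x \<in> S \<and> f x = c" using bound[of x] by simp
next
  assume "x \<in> S \<and> f x = c"
  then show "is_arg_max f (\<lambda>x. x \<in> S) x" using bound by (simp add: is_arg_max_def not_less)
qed

theorem theorem4p14:
  fixes d :: nat and \<delta> :: real
  assumes "d \<ge> 1" and "CARD('n::finite) = d + 1" and "\<delta> > 0"
  shows
    "(\<delta> < 1 \<longrightarrow>
       (\<forall>\<mu> :: (real ^ 'n) measure.
          is_arg_max (geo_energy \<delta>) (\<lambda>\<nu>. \<nu> \<in> sphere_prob_measures) \<mu> \<longleftrightarrow> \<mu> = sphere_sigma)) \<and>
     (\<delta> = 1 \<longrightarrow>
       (\<forall>\<mu> :: (real ^ 'n) measure.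
          is_arg_max (geo_energy \<delta>) (\<lambda>\<nu>. \<nu> \<in> sphere_prob_measures) \<mu> \<longleftrightarrow>
            \<mu> \<in> sphere_prob_measures \<and> centrally_symmetric \<mu>)) \<and>
     (\<delta> > 1 \<longrightarrow>
       (\<forall>\<mu> :: (real ^ 'n) measure.
          is_arg_max (geo_energy \<delta>) (\<lambda>\<nu>. \<nu> \<in> sphere_prob_measures) \<mu> \<longleftrightarrow>
            (\<exists>p\<in>sphere 0 1. \<mu> = antipodal_dirac p)))"
proof (intro conjI impI allI)
  obtain e :: "real ^ 'n" where e: "e \<in> sphere 0 1"
    using vector_choose_size[of 1] by auto
  \<comment> \<open>This measure attains 1/2 for every exponent at least one, so it witnesses
    sharpness of the bound in the last two cases.\<close>
  note dirac_e = antipodal_dirac_properties(1)[OF e] geo_energy_antipodal_dirac[OF e]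
  fix \<mu> :: "(real ^ 'n) measure"
  {
    assume \<delta>: "\<delta> < 1"
    note \<sigma> = sphere_sigma_in_sphere_prob_measures[where 'a="real ^ 'n"]
    have gap: "energy_gap (dist_kernel \<delta>) \<nu> sphere_sigma =
        geo_energy \<delta> \<nu> - geo_energy \<delta> (sphere_sigma :: (real ^ 'n) measure)"
      if "\<nu> \<in> sphere_prob_measures" for \<nu> :: "(real ^ 'n) measure"
      using energy_gap_sphere_sigma[OF that continuous_on_dist_kernel] \<open>0 < \<delta>\<close>
      by (simp add: geo_energy_eq_cross_energy that \<sigma>)
    have "geo_energy \<delta> \<nu> \<le> geo_energy \<delta> (sphere_sigma :: (real ^ 'n) measure)"
      if "\<nu> \<in> sphere_prob_measures" for \<nu> :: "(real ^ 'n) measure"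
      using energy_gap_dist_kernel(1)[OF that \<sigma> \<open>0 < \<delta>\<close> \<delta>] gap[OF that] by simp
    \<comment> \<open>Here the bound is attained by \<open>sphere_sigma\<close> itself; uniqueness
      then follows from the equality case of the gap.\<close>
    then have "is_arg_max (geo_energy \<delta>) (\<lambda>\<nu>. \<nu> \<in> sphere_prob_measures) \<mu> \<longleftrightarrow>
        \<mu> \<in> sphere_prob_measures \<and> geo_energy \<delta> \<mu> = geo_energy \<delta> (sphere_sigma :: (real ^ 'n) measure)"
      by (intro is_arg_max_iff_attains_bound) (auto simp: \<sigma>)
    then show "is_arg_max (geo_energy \<delta>) (\<lambda>\<nu>. \<nu> \<in> sphere_prob_measures) \<mu> \<longleftrightarrow> \<mu> = sphere_sigma"
      using energy_gap_dist_kernel(2)[OF _ \<sigma> \<open>0 < \<delta>\<close> \<delta>] gap \<sigma> by auto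
  next
    assume \<delta>: "\<delta> = 1"
    show "is_arg_max (geo_energy \<delta>) (\<lambda>\<nu>. \<nu> \<in> sphere_prob_measures) \<mu> \<longleftrightarrow>
        \<mu> \<in> sphere_prob_measures \<and> centrally_symmetric \<mu>"
      unfolding \<delta>
      using is_arg_max_iff_attains_bound[where f="geo_energy 1" and S=sphere_prob_measures,
          OF geo_energy_1_bound(1) dirac_e(1) dirac_e(2)[OF order_refl]]
        geo_energy_1_bound(2) by blast
  next
    assume \<delta>: "\<delta> > 1"
    have "geo_energy \<delta> \<nu> \<le> 1/2" if "\<nu> \<in> sphere_prob_measures" for \<nu> :: "(real ^ 'n) measure"
      using geo_energy_le_geo_energy_1(1)[OF that \<delta>] geo_energy_1_bound(1)[OF that] by simp
    then have "is_arg_max (geo_energy \<delta>) (\<lambda>\<nu>. \<nu> \<in> sphere_prob_measures) \<mu> \<longleftrightarrow>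
        \<mu> \<in> sphere_prob_measures \<and> geo_energy \<delta> \<mu> = 1/2"
      using is_arg_max_iff_attains_bound[where f="geo_energy \<delta>" and S=sphere_prob_measures,
          OF _ dirac_e(1) dirac_e(2)] \<delta> by auto
    also have "\<dots> \<longleftrightarrow> (\<exists>p\<in>sphere 0 1. \<mu> = antipodal_dirac p)"
    proof
      assume "\<mu> \<in> sphere_prob_measures \<and> geo_energy \<delta> \<mu> = 1/2"
      then show "\<exists>p\<in>sphere 0 1. \<mu> = antipodal_dirac p"
        by (intro geo_energy_eq_half_imp_antipodal[OF _ \<delta>]) auto
    next
      assume "\<exists>p\<in>sphere 0 1. \<mu> = antipodal_dirac p"
      then obtain p where p: "p \<in> sphere 0 1" and \<mu>: "\<mu> = antipodal_dirac p" by blast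
      show "\<mu> \<in> sphere_prob_measures \<and> geo_energy \<delta> \<mu> = 1/2"
        unfolding \<mu>
        using antipodal_dirac_properties(1)[OF p] geo_energy_antipodal_dirac[OF p less_imp_le[OF \<delta>]]
        by blast
    qed
    finally show "is_arg_max (geo_energy \<delta>) (\<lambda>\<nu>. \<nu> \<in> sphere_prob_measures) \<mu> \<longleftrightarrow>
        (\<exists>p\<in>sphere 0 1. \<mu> = antipodal_dirac p)" .
  }
qed

end
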